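(* Let $0<t<1$, let $A_1,\dots,A_m\in\mathbb{P}$, let $w_1,\dots,w_m$ be positive weights with $\sum_{j=1}^m w_j=1$, and let $\alpha,\beta$ be positive numbers such that $\alpha I\le A_j\le\beta I$ for all $1\le j\le m$. Define $\varphi_t:\mathbb{P}\to\mathbb{R}_+$ by $$\varphi_t(X)=\sum_{j=1}^{m}w_j\left[\mathrm{tr}\big((1-t)A_j+tX\big)-\mathrm{tr}\left(A_j^{\frac{1-t}{2t}}XA_j^{\frac{1-t}{2t}}\right)^{t}\right].$$ Then $\varphi_t$ is strictly convex on $\mathbb{P}$ and has a unique minimizer in $\mathbb{P}$. Moreover, on the set $\{X\in\mathbb{P}:\alpha I\le X\le\beta I\}$, $\varphi_t$ is $t(1-t)\beta^{1-t}\alpha^{t-2}$-smooth and $t(1-t)\beta^{t-2}\alpha^{1-t}$-strongly convex.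
   Context: $\mathbb{P}$ is the set of $n\times n$ complex positive definite matrices, an open subset of the real vector space $\mathbb{H}$ of $n\times n$ complex Hermitian matrices, which carries the inner product $\langle X,Y\rangle=\mathrm{tr}(XY)$ and the Hilbert–Schmidt norm $\|X\|_2=(\mathrm{tr}X^*X)^{1/2}$. $\mathbb{R}_+=[0,\infty)$. For Hermitian matrices, $X\le Y$ means $Y-X$ is positive semidefinite. $\mathrm{tr}(Z)^t$ means the trace of $Z^t$. The gradient $\nabla f(X)\in\mathbb{H}$ of a smooth $f:\mathbb{P}\to\mathbb{R}$ is determined by $Df(X)(Y)=\langle\nabla f(X),Y\rangle$. For a compact convex set $\mathbb{K}\subset\mathbb{P}$ and $k>0$: $f$ is $k$-strongly convex on $\mathbb{K}$ if $f(Y)\ge f(X)+\langle\nabla f(X),Y-X\rangle+\frac{k}{2}\|X-Y\|_2^2$ for all $X,Y\in\mathbb{K}$; $f$ is $k$-smooth on $\mathbb{K}$ if $\|\nabla f(X)-\nabla f(Y)\|_2\le k\|X-Y\|_2$ for all $X,Y\in\mathbb{K}$. *)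

theory Defs
  imports "HOL-Analysis.Analysis"
begin

definition adj :: "complex^'n^'n \<Rightarrow> complex^'n^'n" where
  "adj M = map_matrix cnj (transpose M)"

definition hermitian :: "complex^'n^'n \<Rightarrow> bool" where
  "hermitian M \<longleftrightarrow> adj M = M"

definition unitary :: "complex^'n^'n \<Rightarrow> bool" where
  "unitary U \<longleftrightarrow> adj U ** U = mat 1 \<and> U ** adj U = mat 1"

text \<open>The form \<open>v\<^sup>* M v\<close>; it is automatically real for Hermitian \<open>M\<close>, so taking
  the real part loses nothing below.\<close>
definition qform :: "complex^'n^'n \<Rightarrow> complex^'n \<Rightarrow> real" where
  "qform M v = Re (\<Sum>i\<in>UNIV. cnj (v $ i) * (M *v v) $ i)"

definition psd :: "complex^'n^'n \<Rightarrow> bool" where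
  "psd M \<longleftrightarrow> hermitian M \<and> (\<forall>v. 0 \<le> qform M v)"

definition posdefs :: "(complex^'n^'n) set" where
  "posdefs = {M. hermitian M \<and> (\<forall>v. v \<noteq> 0 \<longrightarrow> 0 < qform M v)}"

definition loewner_le :: "complex^'n^'n \<Rightarrow> complex^'n^'n \<Rightarrow> bool" (infix "\<le>\<^sub>L" 50) where
  "X \<le>\<^sub>L Y \<longleftrightarrow> psd (Y - X)"

definition hs_inner :: "complex^'n^'n \<Rightarrow> complex^'n^'n \<Rightarrow> real" where
  "hs_inner X Y = Re (trace (X ** Y))"

definition hs_norm :: "complex^'n^'n \<Rightarrow> real" where
  "hs_norm X = sqrt (Re (trace (adj X ** X)))"

text \<open>The norm underlying the library's topology and derivatives on matrices is the
  Hilbert--Schmidt norm.\<close>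
lemma hs_norm_eq_norm: "hs_norm X = norm X"
proof -
  have "Re (trace (adj X ** X)) = (\<Sum>i\<in>UNIV. \<Sum>k\<in>UNIV. (cmod (X $ k $ i))\<^sup>2)"
    unfolding cmod_power2
    by (simp add: trace_def matrix_matrix_mult_def adj_def transpose_def power2_eq_square)
  also have "\<dots> = (\<Sum>k\<in>UNIV. \<Sum>i\<in>UNIV. (cmod (X $ k $ i))\<^sup>2)"
    by (rule sum.swap)
  also have "\<dots> = (norm X)\<^sup>2"
    by (simp add: norm_vec_def L2_set_def sum_nonneg)
  finally show ?thesis
    by (simp add: hs_norm_def)
qed

definition diag_real :: "('n \<Rightarrow> real) \<Rightarrow> complex^'n^'n" where
  "diag_real d = (\<chi> i j. if i = j then of_real (d i) else 0)"

text \<open>Real powers by the spectral functional calculus, for positive definite \<open>A\<close>. The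
  result does not depend on the chosen diagonalization, see \<open>mat_powr_diag\<close>.\<close>
definition mat_powr :: "complex^'n^'n \<Rightarrow> real \<Rightarrow> complex^'n^'n" where
  "mat_powr A s = (THE B. \<exists>U d. unitary U \<and> A = U ** diag_real d ** adj U
                             \<and> B = U ** diag_real (\<lambda>i. d i powr s) ** adj U)"

lemma mat_mult_diag_real: "(M ** diag_real d) $ i $ j = M $ i $ j * of_real (d j)"
  by (simp add: matrix_matrix_mult_def diag_real_def if_distrib cong: if_cong)

lemma diag_real_mult_mat: "(diag_real d ** M) $ i $ j = of_real (d i) * M $ i $ j"
  by (simp add: matrix_matrix_mult_def diag_real_def if_distrib if_distribR cong: if_cong)

lemma spectral_calculus_unique:
  assumes U: "unitary U" and V: "unitary V"
    and eq: "U ** diag_real d ** adj U = V ** diag_real e ** adj V"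
  shows "U ** diag_real (\<lambda>i. g (d i)) ** adj U = V ** diag_real (\<lambda>i. g (e i)) ** adj V"
proof -
  have UU: "adj U ** U = mat 1" "U ** adj U = mat 1"
    and VV: "adj V ** V = mat 1" "V ** adj V = mat 1"
    using U V by (auto simp: unitary_def)
  define W where "W = adj V ** U"
  have "W ** diag_real d = adj V ** (U ** diag_real d ** adj U) ** U"
    by (simp add: W_def UU flip: matrix_mul_assoc)
  also have "\<dots> = diag_real e ** W"
    unfolding eq by (simp add: W_def VV matrix_mul_assoc)
  finally have "(W ** diag_real d) $ i $ j = (diag_real e ** W) $ i $ j" for i j
    by simp
  then have "W $ i $ j * of_real (d j) = of_real (e i) * W $ i $ j" for i j
    by (simp add: mat_mult_diag_real diag_real_mult_mat)
  then have "W $ i $ j = 0 \<or> d j = e i" for i j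
    by (metis mult.commute mult_cancel_left of_real_eq_iff)
  then have "W $ i $ j * of_real (g (d j)) = of_real (g (e i)) * W $ i $ j" for i j
    by (metis mult.commute mult_zero_left)
  then have comm: "W ** diag_real (\<lambda>i. g (d i)) = diag_real (\<lambda>i. g (e i)) ** W"
    by (simp add: vec_eq_iff mat_mult_diag_real diag_real_mult_mat)
  have "U ** diag_real (\<lambda>i. g (d i)) ** adj U = V ** (W ** diag_real (\<lambda>i. g (d i))) ** adj U"
    by (simp add: W_def VV matrix_mul_assoc)
  also have "\<dots> = V ** diag_real (\<lambda>i. g (e i)) ** adj V"
    unfolding comm by (simp add: W_def UU flip: matrix_mul_assoc)
  finally show ?thesis .
qed

lemma mat_powr_diag:
  assumes "unitary U" and "A = U ** diag_real d ** adj U"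
  shows "mat_powr A s = U ** diag_real (\<lambda>i. d i powr s) ** adj U"
  unfolding mat_powr_def
proof (rule the_equality)
  fix B
  assume "\<exists>U d. unitary U \<and> A = U ** diag_real d ** adj U
            \<and> B = U ** diag_real (\<lambda>i. d i powr s) ** adj U"
  then show "B = U ** diag_real (\<lambda>i. d i powr s) ** adj U"
    using assms spectral_calculus_unique[where g = "\<lambda>x. x powr s"] by metis
qed (use assms in blast)

text \<open>Functions here live on \<open>posdefs\<close>, which is open in the space of Hermitian matrices but
  not in the space of all matrices; hence the derivative within \<open>posdefs\<close>. Since the gradient
  is Hermitian, the values of \<open>hs_inner G\<close> on Hermitian matrices determine it.\<close>
definition has_gradient ::
    "(complex^'n^'n \<Rightarrow> real) \<Rightarrow> complex^'n^'n \<Rightarrow> complex^'n^'n \<Rightarrow> bool" where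
  "has_gradient f G X \<longleftrightarrow>
     hermitian G \<and> (f has_derivative hs_inner G) (at X within posdefs)"

definition gradient :: "(complex^'n^'n \<Rightarrow> real) \<Rightarrow> complex^'n^'n \<Rightarrow> complex^'n^'n" where
  "gradient f X = (THE G. has_gradient f G X)"

text \<open>Both notions below include that the gradient exists throughout \<open>K\<close>.\<close>
definition k_strongly_convex_on ::
    "real \<Rightarrow> (complex^'n^'n) set \<Rightarrow> (complex^'n^'n \<Rightarrow> real) \<Rightarrow> bool" where
  "k_strongly_convex_on k K f \<longleftrightarrow>
     (\<forall>X\<in>K. has_gradient f (gradient f X) X) \<and>
     (\<forall>X\<in>K. \<forall>Y\<in>K. f Y \<ge> f X + hs_inner (gradient f X) (Y - X) + k / 2 * (hs_norm (X - Y))\<^sup>2)"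

definition k_smooth_on ::
    "real \<Rightarrow> (complex^'n^'n) set \<Rightarrow> (complex^'n^'n \<Rightarrow> real) \<Rightarrow> bool" where
  "k_smooth_on k K f \<longleftrightarrow>
     (\<forall>X\<in>K. has_gradient f (gradient f X) X) \<and>
     (\<forall>X\<in>K. \<forall>Y\<in>K. hs_norm (gradient f X - gradient f Y) \<le> k * hs_norm (X - Y))"

definition strictly_convex_on :: "'a::real_vector set \<Rightarrow> ('a \<Rightarrow> real) \<Rightarrow> bool" where
  "strictly_convex_on S f \<longleftrightarrow> convex S \<and>
     (\<forall>x\<in>S. \<forall>y\<in>S. \<forall>u. x \<noteq> y \<and> 0 < u \<and> u < 1 \<longrightarrow>
        f ((1 - u) *\<^sub>R x + u *\<^sub>R y) < (1 - u) * f x + u * f y)"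

text \<open>All traces occurring here are traces of Hermitian matrices, hence real.\<close>
definition phi ::
    "real \<Rightarrow> nat \<Rightarrow> (nat \<Rightarrow> real) \<Rightarrow> (nat \<Rightarrow> complex^'n^'n) \<Rightarrow> complex^'n^'n \<Rightarrow> real" where
  "phi t m w A X = (\<Sum>j=1..m. w j *
     (Re (trace ((1 - t) *\<^sub>R A j + t *\<^sub>R X)) -
      Re (trace (mat_powr (mat_powr (A j) ((1 - t) / (2 * t)) ** X **
                           mat_powr (A j) ((1 - t) / (2 * t))) t))))"

end

theory Submission
  imports Defs
begin

text \<open>
  Write \<open>r = 1 - t\<close>, \<open>C\<^sub>j = A\<^sub>j powr (r / (2 t))\<close> and \<open>D\<^sub>j = C\<^sub>j\<^sup>-\<^sup>2\<close>. Up to terms that are affine in \<open>X\<close>,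
  \<open>\<phi>\<^sub>t\<close> is a weighted sum of functions \<open>- tr (C X C) powr t\<close>, and everything rests on a good
  description of the gradient of such a function, which is \<open>- t G(X)\<close> with
  \<open>G(X) = C (C X C) powr (- r) C\<close> (\<open>sandwich_power\<close>).

  That this is the gradient comes from Klein's inequality (\<open>klein_powr\<close>): the scalar concave function
  \<open>x powr t\<close> lies below its tangents, and this survives under the trace. Used at both ends of a segment
  from \<open>X\<close> to \<open>Y\<close>, it squeezes the error of the linear approximation between \<open>0\<close> and
  \<open>t \<langle>G(Y) - G(X), Y - X\<rangle>\<close>, so that differentiability follows from continuity of \<open>G\<close>; no derivative
  of eigenvalues is ever taken. At \<open>X = A\<^sub>j\<close> the tangent inequality is \<open>\<phi>\<^sub>t \<ge> 0\<close>.

  The key to the constants is that, because \<open>0 < r < 1\<close>, Stieltjes' formula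
  \<open>c x powr (- r) = \<integral> \<lambda> powr (- r) / (\<lambda> + x) d\<lambda>\<close> over \<open>\<lambda> > 0\<close> turns \<open>G\<close> into an integral of resolvents
  (\<open>sandwich_power_resolvent_integral\<close>):
  \<open>c G(X) = \<integral> \<lambda> powr (- r) (\<lambda> D + X)\<^sup>-\<^sup>1 d\<lambda>\<close>. The non-commuting matrices \<open>C\<close> and \<open>X\<close> now only occur added to
  each other. Since \<open>M\<^sup>-\<^sup>1 - N\<^sup>-\<^sup>1 = M\<^sup>-\<^sup>1 (N - M) N\<^sup>-\<^sup>1\<close>, bounds \<open>a \<le> M, N \<le> b\<close> give
  \<open>\<parallel>M\<^sup>-\<^sup>1 - N\<^sup>-\<^sup>1\<parallel> \<le> \<parallel>M - N\<parallel> / a\<^sup>2\<close> and \<open>\<langle>N - M, M\<^sup>-\<^sup>1 - N\<^sup>-\<^sup>1\<rangle> \<ge> \<parallel>N - M\<parallel>\<^sup>2 / b\<^sup>2\<close>. With \<open>M = \<lambda> D + X\<close> and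
  \<open>N = \<lambda> D + Y\<close> the bounds are scalars \<open>\<lambda> d + a\<close>, and the integral of \<open>\<lambda> powr (- r) / (\<lambda> d + a)\<^sup>2\<close> is
  explicit. This yields exactly the two constants of the theorem: the Lipschitz constant of the
  gradient and its modulus of strong monotonicity, the latter being equivalent to strong convexity.

  Strict convexity follows because any two positive definite matrices and all the \<open>A\<^sub>j\<close> lie in a common order
  interval \<open>a I \<le> X \<le> b I\<close> with \<open>a > 0\<close>. Uniqueness of the minimiser is strict convexity. Existence
  is obtained by reduction to the compact interval \<open>\<alpha> I \<le> X \<le> \<beta> I\<close>: moving the eigenvalues of \<open>X\<close>
  into \<open>[\<alpha>, \<beta>]\<close> does not increase \<open>\<phi>\<^sub>t\<close> (\<open>phi_clamp_le\<close>), because for a unit eigenvector \<open>v\<close> of \<open>Y\<close> with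
  eigenvalue \<open>\<alpha>\<close> the resolvent integral gives \<open>v\<^sup>* G(Y) v \<ge> 1\<close>, and with eigenvalue \<open>\<beta>\<close> it gives
  \<open>v\<^sup>* G(Y) v \<le> 1\<close>, so that the gradient of \<open>\<phi>\<^sub>t\<close> has the right sign in the directions that matter.
\<close>

section \<open>Adjoints and the Hermitian inner product\<close>

text \<open>The real inner product on \<open>complex^'n\<close> is the real part of this form. It suffices almost everywhere;
  complex orthogonality is needed only for eigenbases.\<close>
definition cinner :: "complex^'n \<Rightarrow> complex^'n \<Rightarrow> complex" where
  "cinner v w = (\<Sum>i\<in>UNIV. cnj (v $ i) * w $ i)"

lemma Re_cinner: "Re (cinner v w) = v \<bullet> w"
  by (simp add: cinner_def inner_vec_def inner_complex_def)

lemma cinner_self: "cinner v v = of_real ((norm v)\<^sup>2)"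
proof (rule complex_eqI)
  show "Im (cinner v v) = Im (of_real ((norm v)\<^sup>2))"
    by (simp add: cinner_def mult.commute)
qed (simp add: Re_cinner power2_norm_eq_inner)

lemma cinner_add_right: "cinner v (x + y) = cinner v x + cinner v y"
  by (simp add: cinner_def distrib_left sum.distrib)

lemma cinner_scaleR_right: "cinner v (s *\<^sub>R x) = of_real s * cinner v x"
  by (simp add: cinner_def sum_distrib_left scaleR_conv_of_real[where 'a=complex] algebra_simps)

lemma cinner_commute: "cinner v w = cnj (cinner w v)"
  by (simp add: cinner_def mult.commute)

lemma adj_nth: "adj M $ i $ j = cnj (M $ j $ i)"
  by (simp add: adj_def transpose_def map_matrix_def)

lemma adj_adj [simp]: "adj (adj M) = M"
  by (simp add: vec_eq_iff adj_nth)

lemma adj_mult: "adj (M ** N) = adj N ** adj M"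
  by (simp add: vec_eq_iff adj_nth matrix_matrix_mult_def mult.commute)

lemma adj_add: "adj (M + N) = adj M + adj N"
  by (simp add: vec_eq_iff adj_nth)

lemma adj_diff: "adj (M - N) = adj M - adj N"
  by (simp add: vec_eq_iff adj_nth)

lemma adj_scaleR: "adj (s *\<^sub>R M) = s *\<^sub>R adj M"
  by (simp add: vec_eq_iff adj_nth)

lemma adj_mat_1 [simp]: "adj (mat 1) = mat 1"
  by (simp add: vec_eq_iff adj_nth mat_def)

lemma adj_diag_real [simp]: "adj (diag_real d) = diag_real d"
  by (simp add: vec_eq_iff adj_nth diag_real_def)

lemma linear_adj: "linear adj"
  by (rule linearI) (simp_all add: adj_add adj_scaleR)

lemma norm_adj: "norm (adj M) = norm M"
proof -
  have "(norm (adj M))\<^sup>2 = (norm M)\<^sup>2"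
    unfolding power2_norm_eq_inner inner_vec_def
    by (subst sum.swap) (simp add: adj_nth inner_complex_def)
  then show ?thesis by simp
qed

lemma cinner_adj: "cinner v (M *v w) = cinner (adj M *v v) w"
proof -
  have "cinner v (M *v w) = (\<Sum>i\<in>UNIV. \<Sum>j\<in>UNIV. cnj (v $ i) * M $ i $ j * w $ j)"
    by (simp add: cinner_def matrix_vector_mult_def sum_distrib_left mult.assoc)
  also have "\<dots> = (\<Sum>j\<in>UNIV. \<Sum>i\<in>UNIV. cnj (v $ i) * M $ i $ j * w $ j)"
    by (rule sum.swap)
  also have "\<dots> = cinner (adj M *v v) w"
    by (simp add: cinner_def matrix_vector_mult_def adj_nth sum_distrib_left mult.commute mult.left_commute)
  finally show ?thesis .
qed

lemma inner_adj: "v \<bullet> (M *v w) = (adj M *v v) \<bullet> w"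
  by (metis Re_cinner cinner_adj)

lemma qform_eq_inner: "qform M v = v \<bullet> (M *v v)"
  unfolding Re_cinner[symmetric] by (simp add: qform_def cinner_def)

lemma matrix_linear_simps:
  fixes A B C :: "complex^'n^'n"
  shows "A ** (B + C) = A ** B + A ** C" "(A + B) ** C = A ** C + B ** C"
    "A ** (B - C) = A ** B - A ** C" "(A - B) ** C = A ** C - B ** C"
    "A ** (s *\<^sub>R B) = s *\<^sub>R (A ** B)" "(s *\<^sub>R A) ** B = s *\<^sub>R (A ** B)"
    "(s *\<^sub>R A) *v x = s *\<^sub>R (A *v x)" "A *v (s *\<^sub>R x) = s *\<^sub>R (A *v x)"
    "(A + B) *v x = A *v x + B *v x" "(A - B) *v x = A *v x - B *v x"
    "A *v (x + y) = A *v x + A *v y" "A *v (x - y) = A *v x - A *v y"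
  by (simp_all add: vec_eq_iff matrix_matrix_mult_def matrix_vector_mult_def scaleR_conv_of_real[where 'a=complex]
    sum.distrib sum_subtractf sum_distrib_left algebra_simps)

lemma bounded_linear_mult_vec: "bounded_linear (\<lambda>v. (M :: complex^'n^'n) *v v)"
  by (rule linear_conv_bounded_linear[THEN iffD1]) (auto intro!: linearI simp: matrix_linear_simps)

lemma qform_continuous: "continuous_on S (qform M)"
  unfolding qform_eq_inner[abs_def]
  by (intro continuous_intros linear_continuous_on bounded_linear_mult_vec)

lemma cinner_continuous: "continuous_on S (cinner u)"
  unfolding cinner_def[abs_def] by (intro continuous_intros)

section \<open>The spectral theorem\<close>

text \<open>A square matrix whose rows are the \<open>u j\<close> for \<open>j \<in> S\<close> and zero otherwise is singular, and a kernel vector is orthogonal to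
  all of them.\<close>
lemma exists_orthogonal_unit_vector:
  fixes u :: "'n::finite \<Rightarrow> complex^'n"
  assumes "k \<notin> S"
  shows "\<exists>v. norm v = 1 \<and> (\<forall>j\<in>S. cinner (u j) v = 0)"
proof -
  define M :: "complex^'n^'n" where "M = (\<chi> i j. if i \<in> S then cnj (u i $ j) else 0)"
  have Mv: "(M *v v) $ i = (if i \<in> S then cinner (u i) v else 0)" for v i
    by (simp add: M_def matrix_vector_mult_def cinner_def)
  have "det M = 0"
    by (rule det_zero_row(1)[where i = k]) (use assms in \<open>simp add: row_def M_def vec_eq_iff\<close>)
  then have "\<not> (\<exists>B. B ** M = mat 1)"
    using invertible_det_nz invertible_left_inverse by blast
  then obtain x where x: "M *v x = 0" "x \<noteq> 0"
    unfolding matrix_left_invertible_ker by blast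
  have "cinner (u j) x = 0" if "j \<in> S" for j
    using Mv[of x j] x(1) that by simp
  then show ?thesis
    using x(2) by (intro exI[of _ "(1 / norm x) *\<^sub>R x"]) (auto simp: cinner_scaleR_right)
qed

text \<open>The quadratic form of \<open>A\<close> attains its maximum \<open>\<mu>\<close> on the unit sphere of the orthogonal complement \<open>W\<close> of the given
  eigenvectors, say at \<open>v\<close>. Then \<open>B = \<mu> I - A\<close> is positive semidefinite on \<open>W\<close> and \<open>v\<close> is a zero of its form, so
  the form cannot have a linear term at \<open>v\<close>; in the direction \<open>w = B v\<close>, which lies in \<open>W\<close> since \<open>A\<close> leaves \<open>W\<close> invariant,
  that linear term is \<open>2 \<parallel>w\<parallel>\<^sup>2\<close>.\<close>
lemma rayleigh_maximiser_is_eigenvector: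
  fixes u :: "'n::finite \<Rightarrow> complex^'n"
  assumes A: "adj A = A" and "k \<notin> S"
    and eig: "\<And>j. j \<in> S \<Longrightarrow> A *v u j = d j *\<^sub>R u j"
  shows "\<exists>v \<mu>. norm v = 1 \<and> (\<forall>j\<in>S. cinner (u j) v = 0) \<and> A *v v = \<mu> *\<^sub>R v"
proof -
  define W where "W = {v. \<forall>j\<in>S. cinner (u j) v = 0}"
  have AW: "A *v w \<in> W" if "w \<in> W" for w
    unfolding W_def
  proof safe
    fix j assume j: "j \<in> S"
    have "cinner (u j) (A *v w) = cnj (cinner w (d j *\<^sub>R u j))"
      unfolding cinner_adj A eig[OF j] by (rule cinner_commute)
    also have "\<dots> = of_real (d j) * cinner (u j) w"
      by (simp add: cinner_scaleR_right flip: cinner_commute)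
    finally show "cinner (u j) (A *v w) = 0" using that j by (simp add: W_def)
  qed
  have addW: "x + s *\<^sub>R y \<in> W" if "x \<in> W" "y \<in> W" for x y s
    using that by (simp add: W_def cinner_add_right cinner_scaleR_right)
  let ?K = "sphere 0 1 \<inter> W"
  have "closed W"
  proof -
    have "W = (\<Inter>j\<in>S. {v. cinner (u j) v = 0})"
      by (auto simp: W_def)
    then show ?thesis
      by (simp add: closed_INT closed_Collect_eq[OF cinner_continuous continuous_on_const])
  qed
  then have K: "compact ?K"
    by (intro compact_Int_closed compact_sphere)
  obtain v0 where "norm v0 = 1" "\<forall>j\<in>S. cinner (u j) v0 = 0"
    using exists_orthogonal_unit_vector[OF \<open>k \<notin> S\<close>, of u] by blast
  then have K0: "?K \<noteq> {}"
    by (auto simp: W_def)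
  obtain v where v: "v \<in> ?K" and max: "\<And>y. y \<in> ?K \<Longrightarrow> qform A y \<le> qform A v"
    using continuous_attains_sup[OF K K0 qform_continuous[of _ A]] by blast
  define \<mu> where "\<mu> = qform A v"
  define B where "B = \<mu> *\<^sub>R mat 1 - A"
  have Bq: "qform B y = \<mu> * (norm y)\<^sup>2 - qform A y" for y
    by (simp add: B_def qform_eq_inner matrix_linear_simps inner_diff_right power2_norm_eq_inner)
  have B0: "0 \<le> qform B y" if "y \<in> W" for y
  proof (cases "y = 0")
    case False
    have "(1 / norm y) *\<^sub>R y \<in> ?K"
      using addW[of 0 y "1 / norm y"] that False by (auto simp: W_def cinner_def)
    moreover have "qform A ((1 / norm y) *\<^sub>R y) = qform A y / (norm y)\<^sup>2"
      by (simp add: qform_eq_inner matrix_linear_simps power2_eq_square)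
    ultimately have "qform A y / (norm y)\<^sup>2 \<le> \<mu>"
      using max unfolding \<mu>_def by metis
    then show ?thesis using False by (simp add: Bq field_simps)
  qed (simp add: qform_eq_inner)
  have Bv: "qform B v = 0" using v by (simp add: Bq \<mu>_def)
  define w where "w = B *v v"
  have w: "w \<in> W"
    using addW[OF AW[of v], of v "-\<mu>"] addW[of 0 "A *v v - \<mu> *\<^sub>R v" "-1"] v
    by (auto simp: w_def B_def matrix_linear_simps W_def cinner_def)
  have adjB: "adj B = B"
    by (simp add: B_def adj_diff adj_scaleR A)
  have expand: "qform B (v + s *\<^sub>R w) = 2 * s * (norm w)\<^sup>2 + s\<^sup>2 * qform B w" for s
  proof -
    have "v \<bullet> (B *v w) = w \<bullet> w" by (simp add: inner_adj adjB w_def)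
    moreover have "w \<bullet> (B *v v) = w \<bullet> w" by (simp add: w_def)
    moreover have "v \<bullet> (B *v v) = 0" using Bv by (simp add: qform_eq_inner)
    ultimately show ?thesis
      by (simp add: qform_eq_inner matrix_linear_simps inner_add_left inner_add_right dot_square_norm
        power2_eq_square algebra_simps)
  qed
  have "norm w = 0"
  proof (rule ccontr)
    assume "norm w \<noteq> 0"
    then have n: "(norm w)\<^sup>2 > 0" by simp
    define q where "q = qform B w"
    have q: "q \<ge> 0" using B0 w by (simp add: q_def)
    \<comment> \<open>The minimiser of \<open>2 s \<parallel>w\<parallel>\<^sup>2 + s\<^sup>2 q\<close> would be \<open>- \<parallel>w\<parallel>\<^sup>2 / q\<close>; the summand 1 avoids the case \<open>q = 0\<close>.\<close>
    define s where "s = - (norm w)\<^sup>2 / (q + 1)"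
    have "0 \<le> 2 * s * (norm w)\<^sup>2 + s\<^sup>2 * q"
      using B0[OF addW[OF _ w, of v s]] v expand by (simp add: q_def)
    also have "\<dots> \<le> 2 * s * (norm w)\<^sup>2 + s\<^sup>2 * (q + 1)"
      by (simp add: mult_left_mono)
    also have "\<dots> = s * (2 * (norm w)\<^sup>2 + s * (q + 1))"
      by (simp add: power2_eq_square algebra_simps)
    also have "s * (q + 1) = - (norm w)\<^sup>2"
      using q by (simp add: s_def)
    also have "s * (2 * (norm w)\<^sup>2 + - (norm w)\<^sup>2) < 0"
      using n q by (simp add: s_def zero_less_mult_iff)
    finally show False by simp
  qed
  then have "A *v v = \<mu> *\<^sub>R v"
    by (simp add: w_def B_def matrix_linear_simps)
  then show ?thesis using v by (auto simp: W_def)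
qed

definition spectral :: "complex^'n^'n \<Rightarrow> ('n \<Rightarrow> real) \<Rightarrow> complex^'n^'n" where
  "spectral U d = U ** diag_real d ** adj U"

text \<open>The eigenbasis is built one index at a time; indexing the vectors by the index type of the matrix itself
  makes them the columns of \<open>U\<close>.\<close>
theorem hermitian_spectral:
  fixes A :: "complex^'n^'n"
  assumes "hermitian A"
  obtains U d where "unitary U" "A = spectral U d"
proof -
  have A: "adj A = A" using assms by (simp add: hermitian_def)
  have "\<exists>(u::'n \<Rightarrow> complex^'n) d. (\<forall>i\<in>S. \<forall>j\<in>S. cinner (u i) (u j) = (if i = j then 1 else 0)) \<and>
      (\<forall>j\<in>S. A *v u j = d j *\<^sub>R u j)" if "finite S" for S :: "'n set"
    using that
  proof (induction S)
    case (insert k S)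
    then obtain u d where u: "\<forall>i\<in>S. \<forall>j\<in>S. cinner (u i) (u j) = (if i = j then 1 else 0)"
      and d: "\<forall>j\<in>S. A *v u j = d j *\<^sub>R u j" by blast
    obtain v \<mu> where v: "norm v = 1" "\<And>j. j \<in> S \<Longrightarrow> cinner (u j) v = 0" "A *v v = \<mu> *\<^sub>R v"
      using rayleigh_maximiser_is_eigenvector[OF A insert.hyps(2), of u d] d by blast
    have v': "cinner v (u j) = 0" if "j \<in> S" for j
      using v(2)[OF that] by (metis cinner_commute complex_cnj_zero)
    have "cinner v v = 1" by (simp add: cinner_self v(1))
    then show ?case
      using u d v v' insert.hyps(2)
      by (intro exI[of _ "u(k := v)"] exI[of _ "d(k := \<mu>)"]) auto
  qed simp
  from this[of UNIV] obtain u :: "'n \<Rightarrow> complex^'n" and d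
    where u: "\<And>i j. cinner (u i) (u j) = (if i = j then 1 else 0)"
      and d: "\<And>j. A *v u j = d j *\<^sub>R u j" by auto
  define U where "U = (\<chi> i j. u j $ i)"
  have "adj U ** U = mat 1"
    using u by (simp add: vec_eq_iff matrix_matrix_mult_def adj_nth U_def cinner_def mat_def)
  then have U: "unitary U"
    using matrix_left_right_inverse by (auto simp: unitary_def)
  have "(A ** U) $ i $ j = (U ** diag_real d) $ i $ j" for i j
    using arg_cong[OF d[of j], of "\<lambda>x. x $ i"]
    unfolding mat_mult_diag_real
    by (simp add: U_def matrix_matrix_mult_def matrix_vector_mult_def
        scaleR_conv_of_real[where 'a=complex] mult.commute)
  then have "A ** U = U ** diag_real d" by (simp add: vec_eq_iff)
  then have "A = spectral U d"
    using U by (metis matrix_mul_assoc matrix_mul_rid spectral_def unitary_def)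
  then show ?thesis using that U by blast
qed

section \<open>Spectral calculus and the Loewner order\<close>
lemma cinner_column: "cinner (column i U) (column j U) = (adj U ** U) $ i $ j"
  by (simp add: cinner_def column_def matrix_matrix_mult_def adj_nth)

lemma norm_column_unitary: "unitary U \<Longrightarrow> norm (column i U) = 1"
  using cinner_column[of i U i] by (simp add: unitary_def cinner_self mat_def flip: of_real_power)
    (metis abs_norm_cancel of_real_1 of_real_eq_iff power2_eq_1_iff abs_1 abs_minus)

lemma adj_spectral [simp]: "adj (spectral U d) = spectral U d"
  by (simp add: spectral_def adj_mult matrix_mul_assoc)

lemma hermitian_spectral_form: "hermitian (spectral U d)"
  by (simp add: hermitian_def)

lemma spectral_mult:
  assumes "unitary U"
  shows "spectral U d ** spectral U e = spectral U (\<lambda>i. d i * e i)"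
proof -
  have "spectral U d ** spectral U e = U ** diag_real d ** (adj U ** U) ** diag_real e ** adj U"
    by (simp only: spectral_def matrix_mul_assoc)
  also have "\<dots> = U ** (diag_real d ** diag_real e) ** adj U"
    using assms by (simp add: unitary_def matrix_mul_assoc)
  also have "diag_real d ** diag_real e = diag_real (\<lambda>i. d i * e i)"
    by (simp add: vec_eq_iff diag_real_mult_mat) (simp add: diag_real_def)
  finally show ?thesis by (simp add: spectral_def)
qed

lemma spectral_add: "spectral U d + spectral U e = spectral U (\<lambda>i. d i + e i)"
proof -
  have "diag_real (\<lambda>i. d i + e i) = diag_real d + diag_real e"
    by (simp add: vec_eq_iff diag_real_def)
  then show ?thesis by (simp add: spectral_def matrix_linear_simps)
qed

lemma spectral_scaleR: "s *\<^sub>R spectral U d = spectral U (\<lambda>i. s * d i)"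
proof -
  have "diag_real (\<lambda>i. s * d i) = s *\<^sub>R diag_real d"
    by (simp add: vec_eq_iff diag_real_def scaleR_conv_of_real[where 'a=complex])
  then show ?thesis by (simp add: spectral_def matrix_linear_simps)
qed

lemma spectral_diff: "spectral U d - spectral U e = spectral U (\<lambda>i. d i - e i)"
proof -
  have "diag_real (\<lambda>i. d i - e i) = diag_real d - diag_real e"
    by (simp add: vec_eq_iff diag_real_def)
  then show ?thesis by (simp add: spectral_def matrix_linear_simps)
qed

lemma spectral_1:
  fixes U :: "complex^'n^'n"
  assumes "unitary U" shows "spectral U (\<lambda>_. 1) = mat 1"
proof -
  have "diag_real (\<lambda>_. 1) = (mat 1 :: complex^'n^'n)"
    by (simp add: vec_eq_iff diag_real_def mat_def)
  then show ?thesis using assms by (simp add: spectral_def unitary_def)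
qed

lemma spectral_const: "unitary U \<Longrightarrow> spectral U (\<lambda>_. c) = c *\<^sub>R mat 1"
  using spectral_scaleR[of c U "\<lambda>_. 1"] by (simp add: spectral_1)

lemma spectral_mult_column:
  assumes "unitary U"
  shows "spectral U d *v column i U = d i *\<^sub>R column i U"
proof -
  have "spectral U d ** U = U ** diag_real d ** (adj U ** U)"
    by (simp only: spectral_def matrix_mul_assoc)
  also have "\<dots> = U ** diag_real d"
    using assms by (simp add: unitary_def)
  finally have "(spectral U d ** U) $ k $ i = (U ** diag_real d) $ k $ i" for k
    by simp
  then have "(spectral U d ** U) $ k $ i = U $ k $ i * of_real (d i)" for k
    unfolding mat_mult_diag_real .
  then show ?thesis
    by (simp add: vec_eq_iff matrix_matrix_mult_def matrix_vector_mult_def column_def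
        scaleR_conv_of_real[where 'a=complex] mult.commute)
qed

lemma trace_mult_spectral:
  "trace (M ** spectral U d) = (\<Sum>i\<in>UNIV. of_real (d i) * cinner (column i U) (M *v column i U))"
proof -
  have "trace (M ** spectral U d) = trace (adj U ** (M ** U ** diag_real d))"
    by (simp add: spectral_def matrix_mul_assoc trace_mul_sym[of _ "adj U"])
  also have "\<dots> = trace ((adj U ** (M ** U)) ** diag_real d)"
    by (simp only: matrix_mul_assoc)
  also have "\<dots> = (\<Sum>i\<in>UNIV. (adj U ** (M ** U)) $ i $ i * of_real (d i))"
    unfolding trace_def mat_mult_diag_real ..
  also have "\<dots> = (\<Sum>i\<in>UNIV. of_real (d i) * cinner (column i U) (M *v column i U))"
    by (simp add: matrix_matrix_mult_def[of "adj U"] adj_nth cinner_def column_def mult.commute)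
      (simp add: matrix_matrix_mult_def matrix_vector_mult_def)
  finally show ?thesis .
qed

text \<open>Traces against a diagonalised matrix are weighted sums of quadratic forms at the eigenvectors. Together with the special
  case of the identity this replaces explicit double sums over two eigenbases in all the trace inequalities below.\<close>
lemma hs_inner_spectral: "hs_inner M (spectral U d) = (\<Sum>i\<in>UNIV. d i * qform M (column i U))"
  by (simp add: hs_inner_def trace_mult_spectral qform_eq_inner Re_cinner)

lemma Re_trace_eq_sum_qform:
  assumes "unitary U" shows "Re (trace M) = (\<Sum>i\<in>UNIV. qform M (column i U))"
  using hs_inner_spectral[of M U "\<lambda>_. 1"] spectral_1[OF assms] by (simp add: hs_inner_def)

lemma Re_trace_spectral: "unitary U \<Longrightarrow> Re (trace (spectral U d)) = sum d UNIV"
  using Re_trace_eq_sum_qform[of U "spectral U d"]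
  by (simp add: qform_eq_inner spectral_mult_column dot_square_norm norm_column_unitary)

lemma qform_spectral:
  "qform (spectral U d) v = (\<Sum>i\<in>UNIV. d i * (cmod (cinner (column i U) v))\<^sup>2)"
proof -
  define y where "y = adj U *v v"
  have y: "y $ i = cinner (column i U) v" for i
    by (simp add: y_def matrix_vector_mult_def adj_nth cinner_def column_def)
  have "qform (spectral U d) v = y \<bullet> (diag_real d *v y)"
    by (simp add: qform_eq_inner spectral_def inner_adj y_def flip: matrix_vector_mul_assoc)
  also have "diag_real d *v y = (\<chi> i. d i *\<^sub>R y $ i)"
    by (simp add: vec_eq_iff matrix_vector_mult_def diag_real_def if_distribR if_distrib
        scaleR_conv_of_real[where 'a=complex] cong: if_cong)
  finally show ?thesis
    by (simp add: inner_vec_def dot_square_norm y)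
qed

lemma qform_mat_1: "qform (c *\<^sub>R mat 1) v = c * (norm v)\<^sup>2"
  by (simp add: qform_eq_inner matrix_linear_simps dot_square_norm)

lemma qform_spectral_column: "unitary U \<Longrightarrow> qform (spectral U d) (column i U) = d i"
  by (simp add: qform_eq_inner spectral_mult_column dot_square_norm norm_column_unitary)

lemma qform_add: "qform (A + B) v = qform A v + qform B v"
  and qform_diff: "qform (A - B) v = qform A v - qform B v"
  and qform_scaleR: "qform (c *\<^sub>R A) v = c * qform A v"
  by (simp_all add: qform_eq_inner matrix_linear_simps inner_add_right inner_diff_right)

lemma linear_qform: "linear (\<lambda>X. qform X v)"
  by (rule linearI) (simp_all add: qform_add qform_scaleR)

lemma psd_spectral_iff:
  assumes "unitary U" shows "psd (spectral U d) \<longleftrightarrow> (\<forall>i. 0 \<le> d i)"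
  using qform_spectral_column[OF assms, of d]
  by (auto simp: psd_def hermitian_spectral_form qform_spectral intro!: sum_nonneg) metis

lemma loewner_lower_iff:
  "a *\<^sub>R mat 1 \<le>\<^sub>L M \<longleftrightarrow> hermitian M \<and> (\<forall>v. a * (norm v)\<^sup>2 \<le> qform M v)"
  by (auto simp: loewner_le_def psd_def qform_diff qform_mat_1 hermitian_def adj_diff adj_scaleR)

lemma loewner_upper_iff:
  "M \<le>\<^sub>L b *\<^sub>R mat 1 \<longleftrightarrow> hermitian M \<and> (\<forall>v. qform M v \<le> b * (norm v)\<^sup>2)"
  by (auto simp: loewner_le_def psd_def qform_diff qform_mat_1 hermitian_def adj_diff adj_scaleR)

lemma spectral_lower_bound_iff:
  assumes "unitary U" shows "a *\<^sub>R mat 1 \<le>\<^sub>L spectral U d \<longleftrightarrow> (\<forall>i. a \<le> d i)"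
  unfolding loewner_le_def spectral_const[OF assms, symmetric] spectral_diff psd_spectral_iff[OF assms]
  by simp

lemma spectral_upper_bound_iff:
  assumes "unitary U" shows "spectral U d \<le>\<^sub>L b *\<^sub>R mat 1 \<longleftrightarrow> (\<forall>i. d i \<le> b)"
  unfolding loewner_le_def spectral_const[OF assms, symmetric] spectral_diff psd_spectral_iff[OF assms]
  by simp

lemma lower_bound_posdefs:
  assumes "0 < a" "a *\<^sub>R mat 1 \<le>\<^sub>L M" shows "M \<in> posdefs"
  unfolding posdefs_def
proof (safe)
  show "hermitian M" using assms(2) by (simp add: loewner_lower_iff)
  fix v :: "complex^'a" assume "v \<noteq> 0"
  then have "0 < a * (norm v)\<^sup>2" using assms(1) by simp
  also have "\<dots> \<le> qform M v" using assms(2) by (simp add: loewner_lower_iff)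
  finally show "0 < qform M v" .
qed

lemma spectral_posdefs_iff:
  assumes U: "unitary U" shows "spectral U d \<in> posdefs \<longleftrightarrow> (\<forall>i. 0 < d i)"
proof
  assume P: "spectral U d \<in> posdefs"
  show "\<forall>i. 0 < d i"
  proof
    fix i
    have "column i U \<noteq> 0" using norm_column_unitary[OF U, of i] by auto
    then show "0 < d i"
      using P qform_spectral_column[OF U, of d i] by (force simp: posdefs_def)
  qed
next
  assume d: "\<forall>i. 0 < d i"
  show "spectral U d \<in> posdefs"
  proof (rule lower_bound_posdefs)
    show "0 < Min (range d)" using d by (subst Min_gr_iff) auto
    show "Min (range d) *\<^sub>R mat 1 \<le>\<^sub>L spectral U d"
      using U by (simp add: spectral_lower_bound_iff)
  qed
qed

lemma posdefs_spectral:
  assumes "M \<in> posdefs"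
  obtains U d where "unitary U" "M = spectral U d" "\<And>i. 0 < d i"
proof -
  have "hermitian M" using assms by (simp add: posdefs_def)
  then obtain U d where "unitary U" "M = spectral U d"
    by (rule hermitian_spectral)
  then show ?thesis using that[of U d] assms spectral_posdefs_iff[of U d] by simp
qed

lemma posdefs_bounds:
  assumes "M \<in> posdefs"
  obtains a b where "0 < a" "0 < b" "a *\<^sub>R mat 1 \<le>\<^sub>L M" "M \<le>\<^sub>L b *\<^sub>R mat 1"
proof -
  obtain U d where U: "unitary U" "M = spectral U d" and d: "\<And>i. 0 < d i"
    using posdefs_spectral[OF assms] by blast
  have "0 < Min (range d)" using d by (subst Min_gr_iff) auto
  moreover have "0 < Max (range d)" using d by (subst Max_gr_iff) auto
  ultimately show ?thesis using U
    by (intro that[of "Min (range d)" "Max (range d)"])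
      (auto simp: spectral_lower_bound_iff spectral_upper_bound_iff)
qed

lemma lower_bound_mono: "a *\<^sub>R mat 1 \<le>\<^sub>L M \<Longrightarrow> a' \<le> a \<Longrightarrow> a' *\<^sub>R mat 1 \<le>\<^sub>L M"
  unfolding loewner_lower_iff by (meson mult_right_mono order_trans zero_le_power2)

lemma upper_bound_mono: "M \<le>\<^sub>L b *\<^sub>R mat 1 \<Longrightarrow> b \<le> b' \<Longrightarrow> M \<le>\<^sub>L b' *\<^sub>R mat 1"
  unfolding loewner_upper_iff by (meson mult_right_mono order_trans zero_le_power2)

lemma abs_qform_le: "\<bar>qform H v\<bar> \<le> norm H * (norm v)\<^sup>2"
proof -
  have "norm (H *v v) \<le> norm H * norm v"
  proof -
    have "norm ((H *v v) $ i) \<le> norm (H $ i) * norm v" for i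
    proof -
      have "norm ((H *v v) $ i) \<le> (\<Sum>j\<in>UNIV. norm (H $ i $ j) * norm (v $ j))"
        unfolding matrix_vector_mult_def by (simp add: sum_norm_le norm_mult)
      also have "\<dots> \<le> norm (H $ i) * norm v"
        unfolding norm_vec_def using L2_set_mult_ineq[of "\<lambda>j. norm (H $ i $ j)" "\<lambda>j. norm (v $ j)"] by simp
      finally show ?thesis .
    qed
    then have "norm (H *v v) \<le> L2_set (\<lambda>i. norm (H $ i) * norm v) UNIV"
      unfolding norm_vec_def[of "H *v v"] by (intro L2_set_mono) auto
    also have "\<dots> = norm H * norm v"
      by (simp add: L2_set_left_distrib norm_vec_def[of H])
    finally show ?thesis .
  qed
  then have "norm v * norm (H *v v) \<le> norm v * (norm H * norm v)"
    by (intro mult_left_mono) auto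
  with Cauchy_Schwarz_ineq2[of v "H *v v"] show ?thesis
    by (simp add: qform_eq_inner power2_eq_square mult_ac)
qed

text \<open>Quantitative openness of the positive definite matrices among the Hermitian ones.\<close>
lemma lower_bound_perturb:
  fixes X Y :: "complex^'n^'n"
  assumes X: "a *\<^sub>R mat 1 \<le>\<^sub>L X" and Y: "hermitian Y" and n: "norm (Y - X) \<le> e"
  shows "(a - e) *\<^sub>R mat 1 \<le>\<^sub>L Y"
  unfolding loewner_lower_iff
proof (intro conjI allI Y)
  fix v :: "complex^'n"
  have "norm (Y - X) * (norm v)\<^sup>2 \<le> e * (norm v)\<^sup>2"
    using n by (intro mult_right_mono) auto
  then show "(a - e) * (norm v)\<^sup>2 \<le> qform Y v"
    using X abs_qform_le[of "Y - X" v] by (auto simp: loewner_lower_iff qform_diff algebra_simps dest!: spec[of _ v])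
qed

lemma mat_powr_spectral:
  "unitary U \<Longrightarrow> mat_powr (spectral U d) s = spectral U (\<lambda>i. d i powr s)"
  unfolding spectral_def by (rule mat_powr_diag) auto

lemma mat_powr_posdefs: "M \<in> posdefs \<Longrightarrow> mat_powr M s \<in> posdefs"
  by (elim posdefs_spectral) (simp add: mat_powr_spectral spectral_posdefs_iff, metis less_irrefl)

lemma mat_powr_mult: "M \<in> posdefs \<Longrightarrow> mat_powr M s ** mat_powr M r = mat_powr M (s + r)"
  by (elim posdefs_spectral) (simp add: mat_powr_spectral spectral_mult powr_add)

lemma mat_powr_0: "M \<in> posdefs \<Longrightarrow> mat_powr M 0 = mat 1"
proof (elim posdefs_spectral)
  fix U d assume "unitary U" "M = spectral U d" and d: "\<And>i. 0 < d i"
  moreover have "d i powr 0 = 1" for i using d[of i] by simp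
  ultimately show "mat_powr M 0 = mat 1" by (simp only: mat_powr_spectral spectral_1)
qed

lemma mat_powr_1: "M \<in> posdefs \<Longrightarrow> mat_powr M 1 = M"
  by (elim posdefs_spectral) (simp add: mat_powr_spectral less_imp_le)

lemma mat_powr_powr: "M \<in> posdefs \<Longrightarrow> mat_powr (mat_powr M s) r = mat_powr M (s * r)"
  by (elim posdefs_spectral) (simp add: mat_powr_spectral powr_powr)

lemma mat_powr_lower_bound_neg:
  assumes "M \<in> posdefs" "M \<le>\<^sub>L b *\<^sub>R mat 1" "s \<le> 0"
  shows "(b powr s) *\<^sub>R mat 1 \<le>\<^sub>L mat_powr M s"
  using assms(1)
proof (rule posdefs_spectral)
  fix U d assume "unitary U" "M = spectral U d" "\<And>i. 0 < d i"
  then show ?thesis using assms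
    by (auto simp: mat_powr_spectral spectral_lower_bound_iff spectral_upper_bound_iff
        intro!: powr_mono2')
qed

lemma mat_powr_upper_bound_neg:
  assumes "0 < a" "a *\<^sub>R mat 1 \<le>\<^sub>L M" "s \<le> 0"
  shows "mat_powr M s \<le>\<^sub>L (a powr s) *\<^sub>R mat 1"
  using lower_bound_posdefs[OF assms(1,2)]
proof (rule posdefs_spectral)
  fix U d assume "unitary U" "M = spectral U d" "\<And>i. 0 < d i"
  then show ?thesis using assms
    by (auto simp: mat_powr_spectral spectral_lower_bound_iff spectral_upper_bound_iff
        intro!: powr_mono2')
qed

lemma posdefs_adj: "M \<in> posdefs \<Longrightarrow> adj M = M"
  by (simp add: posdefs_def hermitian_def)

lemma posdefs_add_scaleR:
  assumes "M \<in> posdefs" "N \<in> posdefs" "0 \<le> s"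
  shows "s *\<^sub>R M + N \<in> posdefs"
  using assms unfolding posdefs_def
  by (auto simp: hermitian_def adj_add adj_scaleR qform_add qform_scaleR)
    (metis add_nonneg_pos less_imp_le mult_nonneg_nonneg)

lemma convex_posdefs: "convex posdefs"
proof (rule convexI)
  fix x y :: "complex^'n^'n" and u v :: real
  assume *: "x \<in> posdefs" "y \<in> posdefs" "0 \<le> u" "0 \<le> v" "u + v = 1"
  show "u *\<^sub>R x + v *\<^sub>R y \<in> posdefs"
  proof (cases "v = 0")
    case False
    then have "v *\<^sub>R y + 0 *\<^sub>R y \<in> posdefs" 
      using * by (simp add: posdefs_def hermitian_def adj_scaleR qform_scaleR)
    then show ?thesis using posdefs_add_scaleR[of x "v *\<^sub>R y" u] * by simp
  qed (use * in simp)
qed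

lemma posdefs_congruence:
  assumes C: "C \<in> posdefs" and X: "X \<in> posdefs"
  shows "C ** X ** C \<in> posdefs"
  unfolding posdefs_def
proof safe
  have adj: "adj C = C" "adj X = X" using C X by (auto intro: posdefs_adj)
  show "hermitian (C ** X ** C)" by (simp add: hermitian_def adj_mult adj matrix_mul_assoc)
  fix v :: "complex^'a" assume v: "v \<noteq> 0"
  then have "v \<bullet> (C *v v) > 0" using C by (simp add: posdefs_def qform_eq_inner)
  then have "C *v v \<noteq> 0" by auto
  then have "0 < qform X (C *v v)" using X by (simp add: posdefs_def)
  then show "0 < qform (C ** X ** C) v"
    by (simp add: qform_eq_inner inner_adj[of v C] adj flip: matrix_vector_mul_assoc)
qed

section \<open>Inverses and the trace inner product\<close>
lemma matrix_inv_eqI: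
  fixes M N :: "'a::field^'n^'n"
  assumes "M ** N = mat 1" shows "matrix_inv M = N"
proof -
  have "N ** M = mat 1" using assms by (simp add: matrix_left_right_inverse)
  have "M ** matrix_inv M = mat 1 \<and> matrix_inv M ** M = mat 1"
    unfolding matrix_inv_def by (rule someI[of _ N]) (use assms \<open>N ** M = mat 1\<close> in blast)
  then show ?thesis
    using assms by (metis matrix_mul_assoc matrix_mul_lid matrix_mul_rid)
qed

lemma matrix_inv_spectral:
  assumes "unitary U" "\<And>i. d i \<noteq> 0"
  shows "matrix_inv (spectral U d) = spectral U (\<lambda>i. 1 / d i)"
  by (rule matrix_inv_eqI) (use assms in \<open>simp add: spectral_mult spectral_1\<close>)

lemma posdefs_inv_right: "M \<in> posdefs \<Longrightarrow> M ** matrix_inv M = mat 1"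
proof (elim posdefs_spectral)
  fix U d assume "unitary U" "M = spectral U d" and d: "\<And>i. 0 < d i"
  moreover have "d i \<noteq> 0" for i using d[of i] by simp
  ultimately show "M ** matrix_inv M = mat 1"
    by (simp add: matrix_inv_spectral spectral_mult spectral_1)
qed

lemma posdefs_inv_left: "M \<in> posdefs \<Longrightarrow> matrix_inv M ** M = mat 1"
  using posdefs_inv_right matrix_left_right_inverse by blast

lemma posdefs_inv: "M \<in> posdefs \<Longrightarrow> matrix_inv M \<in> posdefs"
proof (elim posdefs_spectral)
  fix U d assume "unitary U" "M = spectral U d" and d: "\<And>i. 0 < d i"
  moreover have "d i \<noteq> 0" for i using d[of i] by simp
  ultimately show "matrix_inv M \<in> posdefs"
    by (simp add: matrix_inv_spectral spectral_posdefs_iff)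
qed

lemma hs_inner_eq_inner: "hs_inner X Y = adj X \<bullet> Y"
proof -
  have "hs_inner X Y = (\<Sum>i\<in>UNIV. \<Sum>k\<in>UNIV. Re (X $ i $ k * Y $ k $ i))"
    by (simp add: hs_inner_def trace_def matrix_matrix_mult_def)
  also have "\<dots> = (\<Sum>k\<in>UNIV. \<Sum>i\<in>UNIV. Re (X $ i $ k * Y $ k $ i))"
    by (rule sum.swap)
  also have "\<dots> = adj X \<bullet> Y"
    by (simp add: inner_vec_def inner_complex_def adj_nth)
  finally show ?thesis .
qed

lemma hs_inner_commute: "hs_inner X Y = hs_inner Y X"
  unfolding hs_inner_def by (subst trace_mul_sym) simp

lemma hs_inner_hermitian: "hermitian X \<Longrightarrow> hs_inner X Y = X \<bullet> Y"
  by (simp add: hs_inner_eq_inner hermitian_def)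

lemma hs_inner_mult_left: "hs_inner (A ** B) C = hs_inner A (B ** C)"
  by (simp add: hs_inner_def matrix_mul_assoc)

lemma hs_inner_mult_right: "hs_inner A (B ** C) = hs_inner (C ** A) B"
proof -
  have "hs_inner A (B ** C) = Re (trace ((A ** B) ** C))"
    by (simp add: hs_inner_def matrix_mul_assoc)
  then show ?thesis
    by (subst (asm) trace_mul_sym) (simp add: hs_inner_def matrix_mul_assoc)
qed

text \<open>In an eigenbasis of \<open>N\<close> the trace of \<open>M N\<close> is a sum of products of nonnegative numbers.\<close>
lemma hs_inner_psd_nonneg:
  assumes "psd M" "psd N" shows "0 \<le> hs_inner M N"
proof -
  have "hermitian N" using assms(2) by (simp add: psd_def)
  then obtain U d where U: "unitary U" and N: "N = spectral U d" by (rule hermitian_spectral)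
  then have "0 \<le> d i" for i using assms(2) by (simp add: psd_spectral_iff)
  then show ?thesis
    using assms(1) unfolding N hs_inner_spectral by (auto intro!: sum_nonneg simp: psd_def)
qed

lemma posdefs_psd: "M \<in> posdefs \<Longrightarrow> psd M"
proof (elim posdefs_spectral)
  fix U d assume "unitary U" "M = spectral U d" and d: "\<And>i. 0 < d i"
  then show "psd M" using less_imp_le[OF d] by (simp add: psd_spectral_iff)
qed

lemma psd_congruence: "psd P \<Longrightarrow> hermitian H \<Longrightarrow> psd (H ** P ** H)"
  by (auto simp: psd_def hermitian_def adj_mult matrix_mul_assoc qform_eq_inner
      inner_adj[of _ H] simp flip: matrix_vector_mul_assoc)

lemma norm_unitary_mult:
  fixes U M :: "complex^'n^'n"
  assumes "unitary U" shows "norm (U ** M) = norm M"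
proof -
  from assms have "adj (U ** M) ** (U ** M) = adj M ** M"
    by (simp add: adj_mult unitary_def flip: matrix_mul_assoc) (simp add: matrix_mul_assoc unitary_def)
  then show ?thesis by (simp add: hs_norm_def flip: hs_norm_eq_norm)
qed

lemma unitary_adj: "unitary U \<Longrightarrow> unitary (adj U)"
  by (simp add: unitary_def)

lemma norm_spectral_mult_le:
  fixes U H :: "complex^'n^'n"
  assumes U: "unitary U" and d: "\<And>i. \<bar>d i\<bar> \<le> s"
  shows "norm (spectral U d ** H) \<le> s * norm H"
proof -
  have s: "0 \<le> s" using d[of undefined] by linarith
  have "norm (spectral U d ** H) = norm (diag_real d ** (adj U ** H))"
    using norm_unitary_mult[OF U] by (simp add: spectral_def flip: matrix_mul_assoc)
  also have "\<dots> \<le> norm (s *\<^sub>R (adj U ** H))"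
  proof (intro norm_le_componentwise_cart)
    fix i j
    show "norm ((diag_real d ** (adj U ** H)) $ i $ j) \<le> norm ((s *\<^sub>R (adj U ** H)) $ i $ j)"
      using d[of i] s by (simp add: diag_real_mult_mat norm_mult mult_right_mono)
  qed
  also have "\<dots> = s * norm H"
    using s norm_unitary_mult[OF unitary_adj[OF U], of H] by simp
  finally show ?thesis .
qed

lemma norm_inv_mult_le:
  fixes M H :: "complex^'n^'n"
  assumes a: "0 < a" and M: "a *\<^sub>R mat 1 \<le>\<^sub>L M"
  shows "norm (matrix_inv M ** H) \<le> norm H / a" "norm (H ** matrix_inv M) \<le> norm H / a"
proof -
  have *: "norm (matrix_inv M ** K) \<le> norm K / a" for K :: "complex^'n^'n"
    using lower_bound_posdefs[OF a M]
  proof (elim posdefs_spectral)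
    fix U d assume U: "unitary U" "M = spectral U d" and d: "\<And>i. 0 < d i"
    have "a \<le> d i" for i using M U by (simp add: spectral_lower_bound_iff)
    then have "\<bar>1 / d i\<bar> \<le> 1 / a" for i using a d[of i] by (simp add: frac_le)
    from norm_spectral_mult_le[OF U(1) this, where H = K] show ?thesis
      using U d by (subst U(2), subst matrix_inv_spectral) (auto simp: less_imp_neq[THEN not_sym])
  qed
  then show "norm (matrix_inv M ** H) \<le> norm H / a" .
  have "adj (matrix_inv M) = matrix_inv M"
    by (intro posdefs_adj posdefs_inv lower_bound_posdefs[OF a M])
  then have "norm (H ** matrix_inv M) = norm (matrix_inv M ** adj H)"
    using norm_adj[of "H ** matrix_inv M"] by (simp add: adj_mult)
  then show "norm (H ** matrix_inv M) \<le> norm H / a" using *[of "adj H"] by (simp add: norm_adj)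
qed

lemma inv_lower_bound:
  assumes "M \<in> posdefs" and b: "M \<le>\<^sub>L b *\<^sub>R mat 1"
  shows "(1 / b) *\<^sub>R mat 1 \<le>\<^sub>L matrix_inv M"
  using assms(1)
proof (elim posdefs_spectral)
  fix U d assume U: "unitary U" "M = spectral U d" and d: "\<And>i. 0 < d i"
  have "1 / b \<le> 1 / d i" for i using b U d[of i] by (simp add: spectral_upper_bound_iff frac_le)
  moreover have "d i \<noteq> 0" for i using d[of i] by simp
  ultimately show ?thesis using U by (simp add: matrix_inv_spectral spectral_lower_bound_iff)
qed

text \<open>The resolvent identity. Both quantitative facts on the inverse come from it: an upper bound on the two outer
  factors gives the Lipschitz bound, a lower bound gives the strong monotonicity.\<close>
lemma inv_diff:
  assumes "M \<in> posdefs" "N \<in> posdefs"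
  shows "matrix_inv M - matrix_inv N = matrix_inv M ** (N - M) ** matrix_inv N"
proof -
  have "matrix_inv M ** (N - M) ** matrix_inv N
      = matrix_inv M ** (N ** matrix_inv N) - (matrix_inv M ** M) ** matrix_inv N"
    by (simp add: matrix_linear_simps matrix_mul_assoc)
  then show ?thesis using assms by (simp add: posdefs_inv_left posdefs_inv_right)
qed

lemma norm_inv_diff_le:
  assumes a: "0 < a" and M: "a *\<^sub>R mat 1 \<le>\<^sub>L M" and N: "a *\<^sub>R mat 1 \<le>\<^sub>L N"
  shows "norm (matrix_inv M - matrix_inv N) \<le> norm (M - N) / a\<^sup>2"
proof -
  have "norm (matrix_inv M - matrix_inv N) = norm ((matrix_inv M ** (N - M)) ** matrix_inv N)"
    using inv_diff lower_bound_posdefs[OF a] M N by metis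
  also have "\<dots> \<le> norm (matrix_inv M ** (N - M)) / a"
    by (rule norm_inv_mult_le[OF a N])
  also have "\<dots> \<le> norm (N - M) / a / a"
    using norm_inv_mult_le(1)[OF a M] a by (intro divide_right_mono) auto
  finally show ?thesis by (simp add: power2_eq_square norm_minus_commute)
qed

text \<open>With \<open>H = N - M\<close>, \<open>P = M\<^sup>-\<^sup>1\<close> and \<open>Q = N\<^sup>-\<^sup>1\<close> the right-hand side is \<open>tr (H P H Q)\<close>. Replacing first \<open>Q\<close> and then \<open>P\<close>
  by the smaller matrix \<open>I / b\<close> decreases the trace, since each time the difference is the trace of a product of two
  positive semidefinite matrices.\<close>
lemma inv_strongly_antitone:
  assumes M: "M \<in> posdefs" "M \<le>\<^sub>L b *\<^sub>R mat 1" and N: "N \<in> posdefs" "N \<le>\<^sub>L b *\<^sub>R mat 1"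
    and b: "0 < b"
  shows "(norm (N - M))\<^sup>2 / b\<^sup>2 \<le> hs_inner (N - M) (matrix_inv M - matrix_inv N)"
proof -
  define H where "H = N - M"
  define P where "P = matrix_inv M"
  define Q where "Q = matrix_inv N"
  have H: "hermitian H" using M N by (simp add: H_def hermitian_def adj_diff posdefs_adj)
  have P: "psd (P - (1/b) *\<^sub>R mat 1)" and Q: "psd (Q - (1/b) *\<^sub>R mat 1)"
    using inv_lower_bound M N by (simp_all add: P_def Q_def loewner_le_def)
  have psdP: "psd P" unfolding P_def by (rule posdefs_psd[OF posdefs_inv[OF M(1)]])
  have HH: "hs_inner H H = (norm H)\<^sup>2" using H by (simp add: hs_inner_hermitian dot_square_norm)
  have "psd (mat 1 :: complex^'a^'a)"
    by (simp add: psd_def hermitian_def qform_mat_1[of 1, simplified])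
  from psd_congruence[OF this H] have psdHH: "psd (H ** H)" by simp
  have lin: "hs_inner A (B - c *\<^sub>R mat 1) = hs_inner A B - c * hs_inner A (mat 1)"
    "hs_inner (B - c *\<^sub>R mat 1) A = hs_inner B A - c * hs_inner (mat 1) A" for A B :: "complex^'a^'a" and c
    by (simp_all add: hs_inner_eq_inner inner_diff_right inner_diff_left adj_diff adj_scaleR)
  have "0 \<le> hs_inner (P - (1/b) *\<^sub>R mat 1) (H ** H)"
    by (rule hs_inner_psd_nonneg[OF P psdHH])
  also have "\<dots> = hs_inner (H ** P ** H) (mat 1) - (norm H)\<^sup>2 / b"
    using hs_inner_mult_right[of P H H] hs_inner_mult_left[of "H ** P" H "mat 1"]
      hs_inner_mult_right[of "mat 1" H H]
    by (simp add: lin HH)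
  finally have 1: "(norm H)\<^sup>2 / b \<le> hs_inner (H ** P ** H) (mat 1)" by simp
  have "0 \<le> hs_inner (H ** P ** H) (Q - (1/b) *\<^sub>R mat 1)"
    by (rule hs_inner_psd_nonneg[OF psd_congruence[OF psdP H] Q])
  also have "\<dots> = hs_inner H (P ** H ** Q) - hs_inner (H ** P ** H) (mat 1) / b"
    by (simp add: lin hs_inner_mult_left matrix_mul_assoc)
  finally have "hs_inner (H ** P ** H) (mat 1) / b \<le> hs_inner H (P ** H ** Q)" by simp
  moreover have "(norm H)\<^sup>2 / b / b \<le> hs_inner (H ** P ** H) (mat 1) / b"
    using 1 b by (intro divide_right_mono) auto
  ultimately have "(norm H)\<^sup>2 / b / b \<le> hs_inner H (P ** H ** Q)" by linarith
  then show ?thesis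
    using inv_diff[OF M(1) N(1)] by (simp add: H_def P_def Q_def power2_eq_square)
qed

text \<open>Expanding the nonnegative form of \<open>M\<close> at \<open>M\<^sup>-\<^sup>1 v - s v\<close> gives the tangent inequality \<open>1 / x \<ge> 2 s - s\<^sup>2 x\<close> for matrices.\<close>
lemma qform_inv_ge:
  assumes M: "M \<in> posdefs" and v: "norm v = 1" and s: "0 < s" and le: "qform M v \<le> 1 / s"
  shows "s \<le> qform (matrix_inv M) v"
proof -
  define y where "y = matrix_inv M *v v"
  have My: "M *v y = v" using posdefs_inv_right[OF M] by (simp add: y_def matrix_vector_mul_assoc)
  have sym: "y \<bullet> (M *v v) = v \<bullet> v"
    by (simp add: inner_adj[of y] posdefs_adj[OF M] My)
  have "0 \<le> qform M (y - s *\<^sub>R v)"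
    using posdefs_psd[OF M] by (simp add: psd_def)
  also have "\<dots> = qform (matrix_inv M) v - 2 * s + s\<^sup>2 * qform M v"
    using v by (simp add: qform_eq_inner matrix_linear_simps inner_diff_left inner_diff_right My sym
      dot_square_norm power2_eq_square algebra_simps inner_commute[of y v] flip: y_def)
  also have "\<dots> \<le> qform (matrix_inv M) v - 2 * s + s\<^sup>2 * (1 / s)"
    using le by (intro add_left_mono mult_left_mono) auto
  finally show ?thesis using s by (simp add: power2_eq_square)
qed

text \<open>The inverse is antitone in the Loewner order, in the special case of the form at an eigenvector of the smaller matrix \<open>N\<close>,
  where \<open>1 / s\<close> is the eigenvalue.\<close>
lemma qform_inv_le:
  assumes M: "M \<in> posdefs" and N: "psd N" and v: "norm v = 1" and s: "0 < s"
    and NM: "\<And>y. qform N y \<le> qform M y" and Nv: "s *\<^sub>R (N *v v) = v"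
  shows "qform (matrix_inv M) v \<le> s"
proof -
  define y where "y = matrix_inv M *v v"
  have My: "M *v y = v" using posdefs_inv_right[OF M] by (simp add: y_def matrix_vector_mul_assoc)
  define q where "q = qform (matrix_inv M) v"
  have q: "q = y \<bullet> v" by (simp add: q_def qform_eq_inner inner_commute flip: y_def)
  have adjN: "adj N = N" using N by (simp add: psd_def hermitian_def)
  have "N *v v = (1 / s) *\<^sub>R (s *\<^sub>R (N *v v))" using s by simp
  then have Nv': "N *v v = (1 / s) *\<^sub>R v" by (simp only: Nv)
  have sym: "v \<bullet> (N *v y) = y \<bullet> (N *v v)"
    by (simp add: inner_adj[of v] adjN inner_commute)
  have "0 \<le> qform N (y - s *\<^sub>R v)" using N by (simp add: psd_def)
  also have "\<dots> = qform N y - 2 * q + s"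
    using v s by (simp add: qform_eq_inner matrix_linear_simps inner_diff_left inner_diff_right sym Nv'
      dot_square_norm algebra_simps q)
  also have "qform N y \<le> qform M y" by (rule NM)
  also have "qform M y = q" by (simp add: qform_eq_inner My q)
  finally show ?thesis by (simp add: q_def)
qed

section \<open>Klein's inequality for powers\<close>
lemma powr_le_tangent:
  fixes x y t :: real
  assumes "0 < x" "0 < y" "0 < t" "t < 1"
  shows "x powr t \<le> y powr t + t * y powr (t - 1) * (x - y)"
proof -
  define z where "z = x / y"
  have z: "0 < z" using assms by (simp add: z_def)
  have "exp ((1 - t) *\<^sub>R 0 + t *\<^sub>R ln z) \<le> (1 - t) * exp 0 + t * exp (ln z)"
    using assms by (intro convex_onD[OF exp_convex]) auto
  then have "z powr t \<le> 1 + t * (z - 1)"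
    using z by (simp add: powr_def algebra_simps)
  then have "y powr t * z powr t \<le> y powr t * (1 + t * (z - 1))"
    by (intro mult_left_mono) auto
  also have "y powr t * z powr t = x powr t"
    using assms by (simp add: z_def powr_divide)
  also have "y powr t * (1 + t * (z - 1)) = y powr t + t * (y powr t / y) * (x - y)"
    using assms by (simp add: z_def field_simps)
  also have "y powr t / y = y powr (t - 1)"
    using assms by (simp add: powr_diff)
  finally show ?thesis .
qed

text \<open>The tangent inequality for the concave function \<open>x powr t\<close> under the trace. For a fixed eigenvalue \<open>z\<close> of \<open>Z\<close>, the scalar inequality
  at all eigenvalues of \<open>W\<close> says that \<open>F + t (z F' - F' W) - z powr t\<close> is positive semidefinite, where \<open>F = W powr t\<close>
  and \<open>F' = W powr (t - 1)\<close>. Evaluating its form at the eigenvector of \<open>Z\<close> for \<open>z\<close> and summing over an eigenbasis of \<open>Z\<close>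
  gives the claim, although \<open>Z\<close> and \<open>W\<close> need not commute.\<close>
lemma klein_powr:
  assumes Z: "Z \<in> posdefs" and W: "W \<in> posdefs" and t: "0 < t" "t < 1"
  shows "Re (trace (mat_powr Z t)) \<le>
    Re (trace (mat_powr W t)) + t * hs_inner (mat_powr W (t - 1)) (Z - W)"
proof -
  obtain U z where U: "unitary U" and Zs: "Z = spectral U z" and z: "\<And>i. 0 < z i"
    using posdefs_spectral[OF Z] by blast
  obtain V w where V: "unitary V" and Ws: "W = spectral V w" and w: "\<And>i. 0 < w i"
    using posdefs_spectral[OF W] by blast
  define T where "T = (\<lambda>i j. w j powr t + t * w j powr (t - 1) * (z i - w j) - z i powr t)"
  define F where "F = mat_powr W t"
  define F' where "F' = mat_powr W (t - 1)"
  have TV: "spectral V (T i) = F + t *\<^sub>R (z i *\<^sub>R F' - F' ** W) - (z i powr t) *\<^sub>R mat 1" for i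
    unfolding F_def F'_def Ws
    by (simp add: mat_powr_spectral V spectral_scaleR spectral_mult spectral_add spectral_diff T_def
        algebra_simps flip: spectral_const[OF V])
  have "0 \<le> qform (spectral V (T i)) v" for i v
    unfolding qform_spectral using powr_le_tangent[OF z w t]
    by (intro sum_nonneg mult_nonneg_nonneg) (auto simp: T_def)
  then have "0 \<le> (\<Sum>i\<in>UNIV. qform (spectral V (T i)) (column i U))"
    by (intro sum_nonneg) auto
  also have "\<dots> = (\<Sum>i\<in>UNIV. qform F (column i U)) + t * ((\<Sum>i\<in>UNIV. z i * qform F' (column i U))
      - (\<Sum>i\<in>UNIV. qform (F' ** W) (column i U))) - (\<Sum>i\<in>UNIV. z i powr t)"
    by (simp add: TV qform_add qform_diff qform_scaleR qform_mat_1[of 1, simplified] norm_column_unitary[OF U] sum.distrib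
        sum_subtractf flip: sum_distrib_left)
  also have "\<dots> = Re (trace F) + t * (hs_inner F' Z - Re (trace (F' ** W))) - Re (trace (mat_powr Z t))"
    by (simp add: Zs hs_inner_spectral mat_powr_spectral U Re_trace_spectral flip: Re_trace_eq_sum_qform[OF U])
  also have "hs_inner F' Z - Re (trace (F' ** W)) = hs_inner F' (Z - W)"
    by (simp add: hs_inner_def matrix_linear_simps trace_sub)
  finally show ?thesis by (simp add: F_def F'_def)
qed

section \<open>Stieltjes' integral for negative powers\<close>

text \<open>The indicator cuts the integrals over the whole line, where the substitution \<open>x \<mapsto> c x\<close> is most
  convenient, down to the positive half-line.\<close>
definition stieltjes_weight :: "real \<Rightarrow> real \<Rightarrow> real" where
  "stieltjes_weight r x = indicator {0<..} x * x powr (- r)"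

text \<open>For \<open>0 < r < 1\<close> the value is \<open>\<pi> / sin (\<pi> r)\<close>, but only its positivity matters, since it occurs on both sides of every estimate.\<close>
definition stieltjes_const :: "real \<Rightarrow> real" where
  "stieltjes_const r = (LINT x|lborel. stieltjes_weight r x / (x + 1))"

lemma stieltjes_weight_nonneg: "0 \<le> stieltjes_weight r x"
  by (simp add: stieltjes_weight_def indicator_def)

lemma stieltjes_weight_measurable [measurable]: "stieltjes_weight r \<in> borel_measurable borel"
  unfolding stieltjes_weight_def by measurable

lemma integrable_lborel_nonneg:
  fixes f :: "real \<Rightarrow> real"
  assumes "f integrable_on S" "\<And>x. x \<in> S \<Longrightarrow> 0 \<le> f x"
    and [measurable]: "f \<in> borel_measurable borel" "S \<in> sets borel"
  shows "integrable lborel (\<lambda>x. indicator S x * f x)"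
proof -
  have "set_integrable lebesgue S f"
    using nonnegative_absolutely_integrable_1[OF assms(1,2)] .
  then have "integrable lebesgue (\<lambda>x. indicator S x * f x)"
    by (simp add: set_integrable_def)
  moreover have "(\<lambda>x. indicator S x * f x) \<in> lborel \<rightarrow>\<^sub>M borel"
    by measurable
  ultimately show ?thesis by (simp only: integrable_completion)
qed

lemma integrable_stieltjes_weight:
  assumes r: "0 < r" "r < 1"
  shows "integrable lborel (\<lambda>x. stieltjes_weight r x / (x + 1))"
proof (rule Bochner_Integration.integrable_bound)
  have "(\<lambda>x. x powr (- r)) integrable_on {0..1}"
    using has_integral_powr_from_0[of "-r" 1] r by (auto simp: integrable_on_def)
  then have 1: "integrable lborel (\<lambda>x. indicator {0..1} x * x powr (- r))"
    by (rule integrable_lborel_nonneg) auto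
  have "(\<lambda>x. x powr (- r - 1)) integrable_on {1..}"
    using has_integral_powr_to_inf[of "-r-1" 1] r by (auto simp: integrable_on_def)
  then have 2: "integrable lborel (\<lambda>x. indicator {1..} x * x powr (- r - 1))"
    by (rule integrable_lborel_nonneg) auto
  show "integrable lborel (\<lambda>x. indicator {0..1} x * x powr (- r) + indicator {1..} x * x powr (- r - 1))"
    using 1 2 by (rule Bochner_Integration.integrable_add)
  show "AE x in lborel. norm (stieltjes_weight r x / (x + 1)) \<le>
     norm (indicator {0..1} x * x powr (- r) + indicator {1..} x * x powr (- r - 1))"
  proof (rule AE_I2)
    fix x :: real
    consider "x \<le> 0" | "0 < x" "x < 1" | "1 \<le> x" by linarith
    then show "norm (stieltjes_weight r x / (x + 1)) \<le>
      norm (indicator {0..1} x * x powr (- r) + indicator {1..} x * x powr (- r - 1))"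
    proof cases
      case 2
      then have "x powr (- r) / (x + 1) \<le> x powr (- r) / 1"
        by (intro divide_left_mono) auto
      then show ?thesis using 2 by (simp add: stieltjes_weight_def)
    next
      case 3
      then have "x powr (- r) / (x + 1) \<le> x powr (- r) / x"
        by (intro divide_left_mono) auto
      also have "\<dots> = x powr (- r - 1)" using 3 by (simp add: powr_diff)
      also have "\<dots> \<le> \<bar>indicator {0..1} x * x powr (- r) + x powr (- r - 1)\<bar>"
        by (simp add: indicator_def)
      finally show ?thesis using 3 by (simp add: stieltjes_weight_def)
    qed (simp add: stieltjes_weight_def)
  qed
qed measurable

text \<open>By the substitution \<open>x = (a / d) y\<close>, which turns the denominator into \<open>a (y + 1)\<close>.\<close>
lemma stieltjes_weight_integral:
  assumes r: "0 < r" "r < 1" and d: "0 < d" and a: "0 < a"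
  shows "has_bochner_integral lborel (\<lambda>x. stieltjes_weight r x / (x * d + a))
    (stieltjes_const r * d powr (r - 1) * a powr (- r))"
proof -
  define c where "c = a / d"
  have c: "0 < c" using a d by (simp add: c_def)
  have "has_bochner_integral lborel (\<lambda>x. stieltjes_weight r x / (x + 1)) (stieltjes_const r)"
    using integrable_stieltjes_weight[OF r] by (simp add: has_bochner_integral_iff stieltjes_const_def)
  then have "has_bochner_integral lborel (\<lambda>x. c powr (- r) / a * (stieltjes_weight r x / (x + 1)))
      (c powr (- r) / a * stieltjes_const r)"
    by (rule has_bochner_integral_mult_right)
  also have "(\<lambda>x. c powr (- r) / a * (stieltjes_weight r x / (x + 1))) = (\<lambda>x. stieltjes_weight r (0 + c * x) / ((0 + c * x) * d + a))"
  proof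
    fix x
    have "(0 + c * x) * d + a = a * (x + 1)" using d by (simp add: c_def field_simps)
    moreover have "stieltjes_weight r (0 + c * x) = c powr (- r) * stieltjes_weight r x"
      using c by (auto simp: stieltjes_weight_def indicator_def powr_mult zero_less_mult_iff)
    ultimately show "c powr (- r) / a * (stieltjes_weight r x / (x + 1)) = stieltjes_weight r (0 + c * x) / ((0 + c * x) * d + a)"
      by simp
  qed
  also have "c powr (- r) / a * stieltjes_const r = (stieltjes_const r * d powr (r - 1) * a powr (- r)) /\<^sub>R \<bar>c\<bar>"
    using a d c by (simp add: c_def powr_divide powr_minus powr_diff field_simps)
  finally show ?thesis
    using c by (subst lborel_has_bochner_integral_real_affine_iff[of c _ _ 0]) auto
qed

lemma stieltjes_const_pos:
  assumes r: "0 < r" "r < 1" shows "0 < stieltjes_const r"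
proof -
  have "integrable lborel (\<lambda>x. indicator {1..2::real} x * (2 powr (- r) / 3))"
    by simp
  then have "(LINT x|lborel. indicator {1..2::real} x * (2 powr (- r) / 3)) \<le> stieltjes_const r"
    unfolding stieltjes_const_def
  proof (rule integral_mono[OF _ integrable_stieltjes_weight[OF r]])
    fix x :: real
    show "indicator {1..2} x * (2 powr (- r) / 3) \<le> stieltjes_weight r x / (x + 1)"
    proof (cases "x \<in> {1..2}")
      case True
      then have "2 powr (- r) / 3 \<le> x powr (- r) / (x + 1)"
        using r by (intro frac_le powr_mono2') auto
      then show ?thesis using True by (simp add: stieltjes_weight_def)
    next
      case False
      have "0 \<le> stieltjes_weight r x / (x + 1)" by (auto simp: stieltjes_weight_def indicator_def)
      then show ?thesis using False by simp
    qed
  qed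
  moreover have "(LINT x|lborel. indicator {1..2::real} x * (2 powr (- r) / 3)) = 2 powr (- r) / 3"
    by simp
  moreover have "(0::real) < 2 powr (- r) / 3" by simp
  ultimately show ?thesis by linarith
qed

text \<open>This is minus the derivative of the previous integral with respect to \<open>a\<close>. To avoid differentiating under the integral,
  let \<open>F b\<close> be that integral with \<open>b\<close> in place of \<open>a\<close>, and \<open>K\<close> the integral in question. Integrating the tangent
  inequality \<open>1 / (y + b) \<ge> 1 / (y + a) - (b - a) / (y + a)\<^sup>2\<close> shows that \<open>F b + b K\<close> is minimal
  at \<open>b = a\<close>, so its derivative vanishes there.\<close>
lemma stieltjes_weight_square_integral:
  assumes r: "0 < r" "r < 1" and d: "0 < d" and a: "0 < a"
  shows "has_bochner_integral lborel (\<lambda>x. stieltjes_weight r x / (x * d + a)\<^sup>2)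
    (stieltjes_const r * (r * d powr (r - 1) * a powr (- r - 1)))"
proof -
  define f where "f = (\<lambda>x. stieltjes_weight r x / (x * d + a)\<^sup>2)"
  define g where "g = (\<lambda>b x. stieltjes_weight r x / (x * d + b))"
  define F where "F = (\<lambda>b. stieltjes_const r * d powr (r - 1) * b powr (- r))"
  have g: "has_bochner_integral lborel (g b) (F b)" if "0 < b" for b
    using stieltjes_weight_integral[OF r d that] by (simp add: g_def F_def)
  have f: "integrable lborel f"
  proof (rule Bochner_Integration.integrable_bound)
    show "integrable lborel (\<lambda>x. (1 / a) * g a x)"
      using g[OF a] by (intro integrable_mult_right) (simp add: has_bochner_integral_iff)
    show "AE x in lborel. norm (f x) \<le> norm ((1 / a) * g a x)"
    proof (rule AE_I2)
      fix x show "norm (f x) \<le> norm ((1 / a) * g a x)"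
      proof (cases "0 < x")
        case True
        have "stieltjes_weight r x / (x * d + a)\<^sup>2 = (stieltjes_weight r x / (x * d + a)) / (x * d + a)"
          by (simp add: power2_eq_square)
        also have "\<dots> \<le> (stieltjes_weight r x / (x * d + a)) / a"
          using True a d by (intro divide_left_mono divide_nonneg_pos stieltjes_weight_nonneg mult_pos_pos add_pos_pos) auto
        finally show ?thesis using True a d
          by (simp add: f_def g_def stieltjes_weight_nonneg add_nonneg_nonneg mult.commute)
      qed (simp add: f_def g_def stieltjes_weight_def)
    qed
  qed (simp add: f_def)
  define K where "K = integral\<^sup>L lborel f"
  have tangent: "F a + a * K \<le> F b + b * K" if "0 < b" for b
  proof -
    have "has_bochner_integral lborel (\<lambda>x. g a x - (b - a) * f x) (F a - (b - a) * K)"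
      using f g[OF a] by (auto simp: has_bochner_integral_iff K_def)
    then have i0: "F a - (b - a) * K = (LINT x|lborel. g a x - (b - a) * f x)"
      and i1: "integrable lborel (\<lambda>x. g a x - (b - a) * f x)"
      by (simp_all add: has_bochner_integral_iff)
    note i0
    also have "(LINT x|lborel. g a x - (b - a) * f x) \<le> (LINT x|lborel. g b x)"
    proof (rule integral_mono[OF i1])
      show "integrable lborel (g b)" using g[OF that] by (simp add: has_bochner_integral_iff)
      fix x
      show "g a x - (b - a) * f x \<le> g b x"
      proof (cases "0 < x")
        case True
        define y where "y = x * d"
        have y: "0 < y" using True d by (simp add: y_def)
        have "1 / (y + b) - (1 / (y + a) - (b - a) / (y + a)\<^sup>2) = (b - a)\<^sup>2 / ((y + b) * (y + a)\<^sup>2)"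
        proof -
          have "1 / q - (1 / p - (q - p) / p\<^sup>2) = (q - p)\<^sup>2 / (q * p\<^sup>2)" if "0 < p" "0 < q" for p q :: real
            using that by (simp add: divide_simps) (simp add: power2_eq_square algebra_simps)
          from this[of "y + a" "y + b"] show ?thesis using y a that by simp
        qed
        also have "\<dots> \<ge> 0" using y that by simp
        finally have "stieltjes_weight r x * (1 / (y + a) - (b - a) / (y + a)\<^sup>2) \<le> stieltjes_weight r x * (1 / (y + b))"
          by (intro mult_left_mono stieltjes_weight_nonneg) simp
        then show ?thesis by (simp add: g_def f_def y_def algebra_simps)
      qed (simp add: g_def f_def stieltjes_weight_def)
    qed
    also have "\<dots> = F b" using g[OF that] by (simp add: has_bochner_integral_iff)
    finally show ?thesis by (simp add: algebra_simps)
  qed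
  have "((\<lambda>b. F b + b * K) has_real_derivative K - stieltjes_const r * (r * d powr (r - 1) * a powr (- r - 1))) (at a)"
    unfolding F_def using a by (auto intro!: derivative_eq_intros)
  then have "K - stieltjes_const r * (r * d powr (r - 1) * a powr (- r - 1)) = 0"
    by (rule DERIV_local_min[OF _ a]) (auto intro!: tangent)
  then show ?thesis using f by (simp add: has_bochner_integral_iff K_def f_def)
qed

section \<open>The map X to C (C X C) powr (- r) C as an integral of resolvents\<close>

text \<open>For \<open>r = 1 - t\<close> this is, up to the factor \<open>t\<close>, the gradient of \<open>tr (C X C) powr t\<close>.\<close>
definition sandwich_power :: "real \<Rightarrow> complex^'n^'n \<Rightarrow> complex^'n^'n \<Rightarrow> complex^'n^'n" where
  "sandwich_power r C X = C ** mat_powr (C ** X ** C) (- r) ** C"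

lemma bounded_linear_congruence: "bounded_linear (\<lambda>M :: complex^'n^'n. C ** M ** C)"
  by (rule linear_conv_bounded_linear[THEN iffD1]) (auto intro!: linearI simp: matrix_linear_simps)

text \<open>If \<open>D = C\<^sup>-\<^sup>2\<close> then \<open>C (x D + X) C = x I + C X C\<close>: conjugation by \<open>C\<close> turns the pencil \<open>x D + X\<close> into a
  shift of \<open>C X C\<close>, which is inverted eigenvalue by eigenvalue.\<close>
lemma inv_congruence_shift:
  fixes C D X :: "complex^'n^'n"
  assumes C: "C \<in> posdefs" and CDC: "C ** D ** C = mat 1" and x: "0 \<le> x"
    and V: "unitary V" and Z: "C ** X ** C = spectral V z" and z: "\<And>i. 0 < z i"
  shows "matrix_inv (x *\<^sub>R D + X) = C ** spectral V (\<lambda>i. 1 / (x + z i)) ** C"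
proof (rule matrix_inv_eqI)
  define S where "S = spectral V (\<lambda>i. 1 / (x + z i))"
  have ne: "x + z i \<noteq> 0" for i using x z[of i] by linarith
  have "C ** (x *\<^sub>R D + X) ** C = x *\<^sub>R (C ** D ** C) + C ** X ** C"
    by (simp add: matrix_linear_simps)
  also have "\<dots> = spectral V (\<lambda>i. x + z i)"
    unfolding CDC Z spectral_const[OF V, symmetric] spectral_add ..
  finally have "C ** (x *\<^sub>R D + X) ** C ** S = mat 1"
    using V ne by (simp add: S_def spectral_mult spectral_1)
  then have "matrix_inv C ** (C ** (x *\<^sub>R D + X) ** C ** S) ** C = matrix_inv C ** C"
    by simp
  moreover have "matrix_inv C ** (C ** (x *\<^sub>R D + X) ** C ** S) ** C
      = (matrix_inv C ** C) ** ((x *\<^sub>R D + X) ** (C ** S ** C))"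
    by (simp only: matrix_mul_assoc)
  ultimately show "(x *\<^sub>R D + X) ** (C ** spectral V (\<lambda>i. 1 / (x + z i)) ** C) = mat 1"
    using posdefs_inv_left[OF C] by (simp add: S_def)
qed

text \<open>Stieltjes' formula at each eigenvalue of \<open>C X C\<close>, summed against the spectral projections and conjugated by \<open>C\<close>.\<close>
lemma sandwich_power_resolvent_integral:
  fixes C D X :: "complex^'n^'n"
  assumes r: "0 < r" "r < 1" and C: "C \<in> posdefs" and X: "X \<in> posdefs"
    and CDC: "C ** D ** C = mat 1"
  shows "has_bochner_integral lborel (\<lambda>x. stieltjes_weight r x *\<^sub>R matrix_inv (x *\<^sub>R D + X))
    (stieltjes_const r *\<^sub>R sandwich_power r C X)"
proof -
  obtain V z where V: "unitary V" and Z: "C ** X ** C = spectral V z" and z: "\<And>i. 0 < z i"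
    using posdefs_spectral[OF posdefs_congruence[OF C X]] by blast
  define E where "E = (\<lambda>i. spectral V (\<lambda>k. if k = i then 1 else 0))"
  have expand: "(\<Sum>i\<in>UNIV. c i *\<^sub>R E i) = spectral V c" for c
  proof -
    have "(\<Sum>i\<in>S. c i *\<^sub>R E i) = spectral V (\<lambda>k. if k \<in> S then c k else 0)" if "finite S" for S
      using that
    proof (induction S)
      case empty
      have "diag_real (\<lambda>_. 0) = (0 :: complex^'n^'n)" by (simp add: vec_eq_iff diag_real_def)
      then show ?case by (simp add: spectral_def)
    next
      case (insert i S)
      then show ?case
        by (auto simp: E_def spectral_scaleR spectral_add intro!: arg_cong[of _ _ "spectral V"])
    qed
    from this[of UNIV] show ?thesis by simp
  qed
  define T where "T = (\<lambda>M. C ** M ** C)"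
  have "has_bochner_integral lborel (\<lambda>x. T (\<Sum>i\<in>UNIV. (stieltjes_weight r x / (x * 1 + z i)) *\<^sub>R E i))
     (T (\<Sum>i\<in>UNIV. (stieltjes_const r * 1 powr (r - 1) * z i powr (- r)) *\<^sub>R E i))"
    unfolding T_def
    by (intro has_bochner_integral_bounded_linear[OF bounded_linear_congruence]
      has_bochner_integral_sum has_bochner_integral_scaleR_left stieltjes_weight_integral r z) simp
  also have "T (\<Sum>i\<in>UNIV. (stieltjes_const r * 1 powr (r - 1) * z i powr (- r)) *\<^sub>R E i) = stieltjes_const r *\<^sub>R sandwich_power r C X"
    unfolding expand
    by (simp add: T_def sandwich_power_def Z mat_powr_spectral V matrix_linear_simps flip: spectral_scaleR)
  also have "(\<lambda>x. T (\<Sum>i\<in>UNIV. (stieltjes_weight r x / (x * 1 + z i)) *\<^sub>R E i)) =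
      (\<lambda>x. stieltjes_weight r x *\<^sub>R matrix_inv (x *\<^sub>R D + X))"
  proof
    fix x
    show "T (\<Sum>i\<in>UNIV. (stieltjes_weight r x / (x * 1 + z i)) *\<^sub>R E i) = stieltjes_weight r x *\<^sub>R matrix_inv (x *\<^sub>R D + X)"
    proof (cases "0 < x")
      case True
      have "spectral V (\<lambda>i. stieltjes_weight r x / (x * 1 + z i)) = stieltjes_weight r x *\<^sub>R spectral V (\<lambda>i. 1 / (x + z i))"
        by (simp add: spectral_scaleR)
      then show ?thesis
        unfolding expand inv_congruence_shift[OF C CDC less_imp_le[OF True] V Z z]
        by (simp add: T_def matrix_linear_simps)
    next
      case False
      then have "stieltjes_weight r x = 0" by (simp add: stieltjes_weight_def)
      then show ?thesis by (simp add: T_def)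
    qed
  qed
  finally show ?thesis .
qed

lemma lower_bound_shift:
  assumes "d *\<^sub>R mat 1 \<le>\<^sub>L D" "a *\<^sub>R mat 1 \<le>\<^sub>L X" "0 \<le> x"
  shows "(x * d + a) *\<^sub>R mat 1 \<le>\<^sub>L x *\<^sub>R D + X"
  using assms mult_left_mono[of _ _ x]
  by (auto simp: loewner_lower_iff hermitian_def adj_add adj_scaleR qform_add qform_scaleR distrib_right
      mult.assoc intro!: add_mono)

lemma upper_bound_shift:
  assumes "D \<le>\<^sub>L d *\<^sub>R mat 1" "X \<le>\<^sub>L b *\<^sub>R mat 1" "0 \<le> x"
  shows "x *\<^sub>R D + X \<le>\<^sub>L (x * d + b) *\<^sub>R mat 1"
  using assms mult_left_mono[of _ _ x]
  by (auto simp: loewner_upper_iff hermitian_def adj_add adj_scaleR qform_add qform_scaleR distrib_right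
      mult.assoc intro!: add_mono)

text \<open>Under the integral, both resolvents come from matrices bounded below by \<open>x d + a\<close>.\<close>
lemma sandwich_power_lipschitz:
  fixes C D X Y :: "complex^'n^'n"
  assumes r: "0 < r" "r < 1" and C: "C \<in> posdefs" and CDC: "C ** D ** C = mat 1"
    and d: "0 < d" "d *\<^sub>R mat 1 \<le>\<^sub>L D"
    and a: "0 < a" "a *\<^sub>R mat 1 \<le>\<^sub>L X" "a *\<^sub>R mat 1 \<le>\<^sub>L Y"
  shows "norm (sandwich_power r C X - sandwich_power r C Y) \<le> r * d powr (r - 1) * a powr (- r - 1) * norm (X - Y)"
proof -
  let ?F = "\<lambda>x. stieltjes_weight r x *\<^sub>R matrix_inv (x *\<^sub>R D + X) - stieltjes_weight r x *\<^sub>R matrix_inv (x *\<^sub>R D + Y)"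
  let ?g = "\<lambda>x. stieltjes_weight r x / (x * d + a)\<^sup>2 * norm (X - Y)"
  have P: "X \<in> posdefs" "Y \<in> posdefs" using a by (auto intro: lower_bound_posdefs)
  have F: "has_bochner_integral lborel ?F (stieltjes_const r *\<^sub>R sandwich_power r C X - stieltjes_const r *\<^sub>R sandwich_power r C Y)"
    by (intro has_bochner_integral_diff sandwich_power_resolvent_integral r C CDC P)
  have g: "has_bochner_integral lborel ?g (stieltjes_const r * (r * d powr (r - 1) * a powr (- r - 1)) * norm (X - Y))"
    by (intro has_bochner_integral_mult_left stieltjes_weight_square_integral r d a)
  have "norm (integral\<^sup>L lborel ?F) \<le> integral\<^sup>L lborel ?g"
  proof (rule Bochner_Integration.integral_norm_bound_integral)
    fix x :: real
    show "norm (?F x) \<le> ?g x"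
    proof (cases "0 < x")
      case True
      have "norm (matrix_inv (x *\<^sub>R D + X) - matrix_inv (x *\<^sub>R D + Y))
          \<le> norm ((x *\<^sub>R D + X) - (x *\<^sub>R D + Y)) / (x * d + a)\<^sup>2"
        using True d a by (intro norm_inv_diff_le lower_bound_shift add_pos_pos mult_pos_pos) auto
      then have "stieltjes_weight r x * norm (matrix_inv (x *\<^sub>R D + X) - matrix_inv (x *\<^sub>R D + Y))
          \<le> stieltjes_weight r x * (norm (X - Y) / (x * d + a)\<^sup>2)"
        by (intro mult_left_mono stieltjes_weight_nonneg) simp
      then show ?thesis
        by (simp add: stieltjes_weight_nonneg flip: scaleR_diff_right)
    qed (simp add: stieltjes_weight_def)
  qed (use F g in \<open>auto simp: has_bochner_integral_iff\<close>)
  then have "stieltjes_const r * norm (sandwich_power r C X - sandwich_power r C Y)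
      \<le> stieltjes_const r * (r * d powr (r - 1) * a powr (- r - 1) * norm (X - Y))"
    using F g stieltjes_const_pos[OF r]
    by (simp add: has_bochner_integral_integral_eq mult.assoc flip: scaleR_diff_right)
  then show ?thesis using stieltjes_const_pos[OF r] by simp
qed

text \<open>Under the integral, both resolvents come from matrices bounded above by \<open>x d + b\<close>.\<close>
lemma sandwich_power_strongly_antitone:
  fixes C D X Y :: "complex^'n^'n"
  assumes r: "0 < r" "r < 1" and C: "C \<in> posdefs" and CDC: "C ** D ** C = mat 1"
    and d: "0 < d" "D \<in> posdefs" "D \<le>\<^sub>L d *\<^sub>R mat 1"
    and b: "0 < b" "X \<le>\<^sub>L b *\<^sub>R mat 1" "Y \<le>\<^sub>L b *\<^sub>R mat 1" and P: "X \<in> posdefs" "Y \<in> posdefs"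
  shows "r * d powr (r - 1) * b powr (- r - 1) * (norm (Y - X))\<^sup>2
    \<le> hs_inner (Y - X) (sandwich_power r C X - sandwich_power r C Y)"
proof -
  define T where "T = (\<lambda>M. hs_inner (Y - X) M)"
  have bl: "bounded_linear T"
    unfolding T_def hs_inner_eq_inner by (rule bounded_linear_inner_right)
  have Tlin: "T (s *\<^sub>R M - s *\<^sub>R N) = s * T (M - N)" for s M N
    using bl by (metis linear_simps(5) real_scaleR_def scaleR_diff_right)
  let ?F = "\<lambda>x. T (stieltjes_weight r x *\<^sub>R matrix_inv (x *\<^sub>R D + X) - stieltjes_weight r x *\<^sub>R matrix_inv (x *\<^sub>R D + Y))"
  let ?g = "\<lambda>x. stieltjes_weight r x / (x * d + b)\<^sup>2 * (norm (Y - X))\<^sup>2"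
  have F: "has_bochner_integral lborel ?F (T (stieltjes_const r *\<^sub>R sandwich_power r C X - stieltjes_const r *\<^sub>R sandwich_power r C Y))"
    by (intro has_bochner_integral_bounded_linear[OF bl] has_bochner_integral_diff
        sandwich_power_resolvent_integral r C CDC P)
  have g: "has_bochner_integral lborel ?g (stieltjes_const r * (r * d powr (r - 1) * b powr (- r - 1)) * (norm (Y - X))\<^sup>2)"
    by (intro has_bochner_integral_mult_left stieltjes_weight_square_integral r d b)
  have "integral\<^sup>L lborel ?g \<le> integral\<^sup>L lborel ?F"
  proof (rule integral_mono)
    fix x :: real
    show "?g x \<le> ?F x"
    proof (cases "0 < x")
      case True
      have "(norm ((x *\<^sub>R D + Y) - (x *\<^sub>R D + X)))\<^sup>2 / (x * d + b)\<^sup>2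
        \<le> hs_inner ((x *\<^sub>R D + Y) - (x *\<^sub>R D + X)) (matrix_inv (x *\<^sub>R D + X) - matrix_inv (x *\<^sub>R D + Y))"
        using True d b P
        by (intro inv_strongly_antitone upper_bound_shift posdefs_add_scaleR add_pos_pos mult_pos_pos) auto
      then have "stieltjes_weight r x * ((norm (Y - X))\<^sup>2 / (x * d + b)\<^sup>2)
          \<le> stieltjes_weight r x * T (matrix_inv (x *\<^sub>R D + X) - matrix_inv (x *\<^sub>R D + Y))"
        by (intro mult_left_mono stieltjes_weight_nonneg) (simp add: T_def)
      then show ?thesis by (simp add: Tlin)
    qed (simp add: stieltjes_weight_def T_def hs_inner_eq_inner)
  qed (use F g in \<open>auto simp: has_bochner_integral_iff\<close>)
  then have "stieltjes_const r * (r * d powr (r - 1) * b powr (- r - 1) * (norm (Y - X))\<^sup>2)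
      \<le> stieltjes_const r * T (sandwich_power r C X - sandwich_power r C Y)"
    using F g by (simp add: has_bochner_integral_integral_eq mult.assoc Tlin)
  then show ?thesis using stieltjes_const_pos[OF r] by (simp add: T_def)
qed

lemma qform_sandwich_power_integral:
  fixes C D X :: "complex^'n^'n"
  assumes r: "0 < r" "r < 1" and C: "C \<in> posdefs" and X: "X \<in> posdefs"
    and CDC: "C ** D ** C = mat 1"
  shows "has_bochner_integral lborel (\<lambda>x. stieltjes_weight r x * qform (matrix_inv (x *\<^sub>R D + X)) v)
    (stieltjes_const r * qform (sandwich_power r C X) v)"
proof -
  have "bounded_linear (\<lambda>M :: complex^'n^'n. qform M v)"
    by (simp add: linear_qform flip: linear_conv_bounded_linear)
  from has_bochner_integral_bounded_linear[OF this sandwich_power_resolvent_integral[OF assms]]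
  show ?thesis by (simp add: qform_scaleR)
qed

text \<open>At an eigenvector of \<open>X\<close> the form of \<open>x D + X\<close> is at most \<open>x d + a\<close>, however \<open>X\<close> acts on
  the orthogonal complement.\<close>
lemma qform_sandwich_power_ge:
  fixes C D X :: "complex^'n^'n"
  assumes r: "0 < r" "r < 1" and C: "C \<in> posdefs" and CDC: "C ** D ** C = mat 1"
    and d: "0 < d" "D \<in> posdefs" "D \<le>\<^sub>L d *\<^sub>R mat 1"
    and X: "X \<in> posdefs" and a: "0 < a" "X *v v = a *\<^sub>R v" and v: "norm v = 1"
  shows "d powr (r - 1) * a powr (- r) \<le> qform (sandwich_power r C X) v"
proof -
  note F = qform_sandwich_power_integral[OF r C X CDC, of v]
  note g = stieltjes_weight_integral[OF r d(1) a(1)]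
  have "(LINT x|lborel. stieltjes_weight r x / (x * d + a)) \<le> (LINT x|lborel. stieltjes_weight r x * qform (matrix_inv (x *\<^sub>R D + X)) v)"
  proof (rule integral_mono)
    fix x :: real
    show "stieltjes_weight r x / (x * d + a) \<le> stieltjes_weight r x * qform (matrix_inv (x *\<^sub>R D + X)) v"
    proof (cases "0 < x")
      case True
      have "qform X v = a" using v by (simp add: qform_eq_inner a dot_square_norm)
      moreover have "qform D v \<le> d" using d(3) v by (auto simp: loewner_upper_iff dest!: spec[of _ v])
      ultimately have "qform (x *\<^sub>R D + X) v \<le> x * d + a"
        using True by (simp add: qform_add qform_scaleR)
      then have "1 / (x * d + a) \<le> qform (matrix_inv (x *\<^sub>R D + X)) v"
        using True d a X v by (intro qform_inv_ge posdefs_add_scaleR) (auto intro!: add_pos_pos)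
      then have "stieltjes_weight r x * (1 / (x * d + a)) \<le> stieltjes_weight r x * qform (matrix_inv (x *\<^sub>R D + X)) v"
        by (intro mult_left_mono stieltjes_weight_nonneg)
      then show ?thesis by simp
    qed (simp add: stieltjes_weight_def)
  qed (use F g in \<open>auto simp: has_bochner_integral_iff\<close>)
  then have "stieltjes_const r * (d powr (r - 1) * a powr (- r)) \<le> stieltjes_const r * qform (sandwich_power r C X) v"
    using F g by (simp add: has_bochner_integral_integral_eq mult.assoc)
  then show ?thesis using stieltjes_const_pos[OF r] by simp
qed

lemma qform_sandwich_power_le:
  fixes C D X :: "complex^'n^'n"
  assumes r: "0 < r" "r < 1" and C: "C \<in> posdefs" and CDC: "C ** D ** C = mat 1"
    and d: "0 < d" "d *\<^sub>R mat 1 \<le>\<^sub>L D"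
    and X: "X \<in> posdefs" and b: "0 < b" "X *v v = b *\<^sub>R v" and v: "norm v = 1"
  shows "qform (sandwich_power r C X) v \<le> d powr (r - 1) * b powr (- r)"
proof -
  note F = qform_sandwich_power_integral[OF r C X CDC, of v]
  note g = stieltjes_weight_integral[OF r d(1) b(1)]
  have "(LINT x|lborel. stieltjes_weight r x * qform (matrix_inv (x *\<^sub>R D + X)) v) \<le> (LINT x|lborel. stieltjes_weight r x / (x * d + b))"
  proof (rule integral_mono)
    fix x :: real
    show "stieltjes_weight r x * qform (matrix_inv (x *\<^sub>R D + X)) v \<le> stieltjes_weight r x / (x * d + b)"
    proof (cases "0 < x")
      case True
      \<comment> \<open>Replacing \<open>D\<close> by its lower bound makes \<open>v\<close> an eigenvector.\<close>
      define N where "N = (x * d) *\<^sub>R mat 1 + X"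
      have pos: "0 < x * d + b" using True d b by (intro add_pos_pos mult_pos_pos)
      have "hermitian D" using d(2) by (simp add: loewner_lower_iff)
      have D: "D \<in> posdefs" by (rule lower_bound_posdefs[OF d])
      have "qform (matrix_inv (x *\<^sub>R D + X)) v \<le> 1 / (x * d + b)"
      proof (rule qform_inv_le)
        show "x *\<^sub>R D + X \<in> posdefs" using True D X by (intro posdefs_add_scaleR) auto
        show "psd N" using X True d
          by (auto simp: N_def psd_def hermitian_def adj_add adj_scaleR qform_add qform_mat_1
              posdefs_adj dest: posdefs_psd)
        show "qform N y \<le> qform (x *\<^sub>R D + X) y" for y
          using d True mult_left_mono[of "d * (norm y)\<^sup>2" "qform D y" x]
          by (simp add: N_def qform_add qform_mat_1[of 1, simplified] qform_scaleR loewner_lower_iff mult.assoc)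
        have "N *v v = (x * d + b) *\<^sub>R v"
          by (simp add: N_def matrix_linear_simps b scaleR_add_left)
        then show "(1 / (x * d + b)) *\<^sub>R (N *v v) = v" using pos by simp
      qed (use v pos in auto)
      then have "stieltjes_weight r x * qform (matrix_inv (x *\<^sub>R D + X)) v \<le> stieltjes_weight r x * (1 / (x * d + b))"
        by (intro mult_left_mono stieltjes_weight_nonneg)
      then show ?thesis by simp
    qed (simp add: stieltjes_weight_def)
  qed (use F g in \<open>auto simp: has_bochner_integral_iff\<close>)
  then have "stieltjes_const r * qform (sandwich_power r C X) v \<le> stieltjes_const r * (d powr (r - 1) * b powr (- r))"
    using F g by (simp add: has_bochner_integral_integral_eq mult.assoc)
  then show ?thesis using stieltjes_const_pos[OF r] by simp
qed

section \<open>Gradients\<close>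
lemma Re_trace_affine: "Re (trace (a *\<^sub>R M + b *\<^sub>R N)) = a * Re (trace M) + b * Re (trace N)"
  by (simp add: trace_def sum.distrib sum_distrib_left)

definition sandwich_trace :: "real \<Rightarrow> complex^'n^'n \<Rightarrow> complex^'n^'n \<Rightarrow> real" where
  "sandwich_trace t C X = Re (trace (mat_powr (C ** X ** C) t))"

text \<open>Klein's inequality for \<open>Z = C Y C\<close> and \<open>W = C X C\<close>, with one factor \<open>C\<close> moved cyclically to each side of \<open>W powr (t - 1)\<close>.\<close>
lemma sandwich_trace_tangent:
  assumes t: "0 < t" "t < 1" and C: "C \<in> posdefs" and X: "X \<in> posdefs" and Y: "Y \<in> posdefs"
  shows "sandwich_trace t C Y \<le> sandwich_trace t C X + t * hs_inner (sandwich_power (1 - t) C X) (Y - X)"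
proof -
  define F where "F = mat_powr (C ** X ** C) (t - 1)"
  have "sandwich_trace t C Y \<le> sandwich_trace t C X + t * hs_inner F (C ** Y ** C - C ** X ** C)"
    unfolding F_def sandwich_trace_def by (intro klein_powr posdefs_congruence C X Y t)
  also have "C ** Y ** C - C ** X ** C = C ** (Y - X) ** C"
    by (simp add: matrix_linear_simps)
  also have "hs_inner F (C ** (Y - X) ** C) = hs_inner (C ** F ** C) (Y - X)"
    using hs_inner_mult_right[of F "C ** (Y - X)" C] hs_inner_mult_left[of "C ** F" C "Y - X"] by simp
  also have "C ** F ** C = sandwich_power (1 - t) C X"
    by (simp add: F_def sandwich_power_def)
  finally show ?thesis .
qed

lemma mat_1_posdefs: "mat 1 \<in> posdefs"
  by (rule lower_bound_posdefs[of 1])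
    (simp_all add: loewner_lower_iff[of 1, simplified] hermitian_def qform_mat_1[of 1, simplified])

text \<open>The Lipschitz bound is formulated with a matrix \<open>D\<close> that plays the role of \<open>C\<^sup>-\<^sup>2\<close>.\<close>
lemma congruence_to_identity:
  assumes "C \<in> posdefs"
  obtains D where "D \<in> posdefs" "C ** D ** C = mat 1"
proof
  show "matrix_inv C ** mat 1 ** matrix_inv C \<in> posdefs"
    by (rule posdefs_congruence[OF posdefs_inv[OF assms] mat_1_posdefs])
  show "C ** (matrix_inv C ** mat 1 ** matrix_inv C) ** C = mat 1"
    using posdefs_inv_left[OF assms] posdefs_inv_right[OF assms]
    by (simp add: matrix_mul_assoc)
qed

lemma sandwich_power_posdefs:
  assumes "C \<in> posdefs" "X \<in> posdefs" shows "sandwich_power r C X \<in> posdefs"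
  unfolding sandwich_power_def by (intro posdefs_congruence mat_powr_posdefs assms)

lemma sandwich_power_hermitian:
  assumes "C \<in> posdefs" "X \<in> posdefs" shows "hermitian (sandwich_power r C X)"
  using posdefs_adj[OF sandwich_power_posdefs[OF assms]] by (simp add: hermitian_def)

text \<open>The tangent inequalities at \<open>X\<close> and at \<open>Y\<close> enclose the error of the linear approximation between
  \<open>t \<langle>G(Y) - G(X), Y - X\<rangle>\<close> and \<open>0\<close>. As \<open>G\<close> is Lipschitz near \<open>X\<close>, the error is even quadratic in \<open>\<parallel>Y - X\<parallel>\<close>.\<close>
lemma has_derivative_sandwich_trace:
  fixes C X :: "complex^'n^'n"
  assumes t: "0 < t" "t < 1" and C: "C \<in> posdefs" and X: "X \<in> posdefs"
  shows "(sandwich_trace t C has_derivative (\<lambda>H. t * hs_inner (sandwich_power (1 - t) C X) H)) (at X within posdefs)"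
  unfolding has_derivative_within_alt
proof (intro conjI allI impI)
  let ?G = "sandwich_power (1 - t) C"
  show "bounded_linear (\<lambda>H. t * hs_inner (?G X) H)"
    unfolding hs_inner_eq_inner by (intro bounded_linear_const_mult bounded_linear_inner_right)
  fix e :: real assume e: "0 < e"
  obtain D where D: "D \<in> posdefs" "C ** D ** C = mat 1"
    using congruence_to_identity[OF C] .
  obtain d where d: "0 < d" "d *\<^sub>R mat 1 \<le>\<^sub>L D"
    using posdefs_bounds[OF D(1)] by blast
  obtain a where a: "0 < a" "a *\<^sub>R mat 1 \<le>\<^sub>L X"
    using posdefs_bounds[OF X] by blast
  define L where "L = (1 - t) * d powr ((1 - t) - 1) * (a/2) powr (- (1 - t) - 1)"
  have L: "0 < L" using a t d by (simp add: L_def)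
  \<comment> \<open>The first bound keeps \<open>Y \<ge> a/2\<close>, where \<open>L\<close> is a Lipschitz constant; the second makes \<open>t L \<parallel>Y - X\<parallel> \<le> e\<close>.\<close>
  define \<delta> where "\<delta> = min (a/2) (e / (t * L))"
  have "norm (sandwich_trace t C Y - sandwich_trace t C X - t * hs_inner (?G X) (Y - X)) \<le> e * norm (Y - X)"
    if Y: "Y \<in> posdefs" and n: "norm (Y - X) < \<delta>" for Y
  proof -
    have "norm (Y - X) \<le> a/2" using n by (simp add: \<delta>_def)
    from lower_bound_perturb[OF a(2) _ this] Y have Ya: "(a/2) *\<^sub>R mat 1 \<le>\<^sub>L Y"
      by (simp add: posdefs_def)
    have Xa: "(a/2) *\<^sub>R mat 1 \<le>\<^sub>L X" using a by (auto intro: lower_bound_mono)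
    have lip: "norm (?G X - ?G Y) \<le> L * norm (X - Y)"
      unfolding L_def using a t by (intro sandwich_power_lipschitz[OF _ _ C D(2) d _ Xa Ya]) auto
    have up: "sandwich_trace t C Y - sandwich_trace t C X - t * hs_inner (?G X) (Y - X) \<le> 0"
      using sandwich_trace_tangent[OF t C X Y] by simp
    have "hs_inner (?G Y) (X - Y) = - hs_inner (?G Y) (Y - X)"
      by (simp add: hs_inner_eq_inner inner_diff_right)
    then have "t * (hs_inner (?G Y) (Y - X) - hs_inner (?G X) (Y - X)) \<le>
        sandwich_trace t C Y - sandwich_trace t C X - t * hs_inner (?G X) (Y - X)"
      using sandwich_trace_tangent[OF t C Y X] by (simp add: algebra_simps)
    with up have "\<bar>sandwich_trace t C Y - sandwich_trace t C X - t * hs_inner (?G X) (Y - X)\<bar>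
       \<le> t * \<bar>hs_inner (?G Y) (Y - X) - hs_inner (?G X) (Y - X)\<bar>"
      using t by (simp add: abs_mult[symmetric] flip: abs_mult_pos)
        (smt (verit) mult_nonneg_nonneg mult_minus_right)
    also have "hs_inner (?G Y) (Y - X) - hs_inner (?G X) (Y - X) = (?G Y - ?G X) \<bullet> (Y - X)"
      using sandwich_power_hermitian[OF C X] sandwich_power_hermitian[OF C Y]
      by (simp add: hs_inner_hermitian inner_diff_left)
    also have "\<bar>\<dots>\<bar> \<le> norm (?G Y - ?G X) * norm (Y - X)" by (rule Cauchy_Schwarz_ineq2)
    also have "\<dots> \<le> (L * norm (Y - X)) * norm (Y - X)"
      using lip by (intro mult_right_mono) (simp_all add: norm_minus_commute)
    also have "\<dots> \<le> (L * (e / (t * L))) * norm (Y - X)"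
      using n L by (intro mult_right_mono mult_left_mono) (auto simp: \<delta>_def)
    also have "t * \<dots> = e * norm (Y - X)" using L t by simp
    finally show ?thesis using t by simp
  qed
  moreover have "0 < \<delta>" using a e L t by (simp add: \<delta>_def)
  ultimately show "\<exists>d>0. \<forall>y\<in>posdefs. norm (y - X) < d \<longrightarrow>
      norm (sandwich_trace t C y - sandwich_trace t C X - t * hs_inner (?G X) (y - X)) \<le> e * norm (y - X)"
    by blast
qed

text \<open>Derivatives within a set without interior are not unique in general. Here \<open>H = G' - G\<close> is itself an admissible direction:
  \<open>X + s H\<close> stays positive definite for small \<open>s\<close> of either sign, and along this line both derivatives must agree, so that
  \<open>\<langle>H, H\<rangle> = 0\<close>.\<close>
lemma gradient_eqI:
  fixes X :: "complex^'n^'n"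
  assumes X: "X \<in> posdefs" and G: "has_gradient f G X"
  shows "gradient f X = G"
  unfolding gradient_def
proof (rule the_equality, rule G)
  fix G' assume G': "has_gradient f G' X"
  define H where "H = G' - G"
  have H: "hermitian H" using G G' by (simp add: H_def has_gradient_def hermitian_def adj_diff)
  have "((\<lambda>Y. f Y - f Y) has_derivative (\<lambda>Y. hs_inner G' Y - hs_inner G Y)) (at X within posdefs)"
    using G G' unfolding has_gradient_def by (intro has_derivative_diff) auto
  moreover have "(\<lambda>Y. hs_inner G' Y - hs_inner G Y) = hs_inner H"
    by (simp add: fun_eq_iff H_def hs_inner_eq_inner adj_diff inner_diff_left)
  ultimately have zero: "((\<lambda>Y. 0::real) has_derivative hs_inner H) (at X within posdefs)"
    by simp
  obtain a where a: "0 < a" "a *\<^sub>R mat 1 \<le>\<^sub>L X"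
    using posdefs_bounds[OF X] by blast
  define \<delta> where "\<delta> = a / (norm H + 1)"
  have \<delta>: "0 < \<delta>" using a by (simp add: \<delta>_def add_nonneg_pos)
  let ?I = "{-\<delta><..<\<delta>}"
  have path: "X + s *\<^sub>R H \<in> posdefs" if "s \<in> ?I" for s
  proof (rule lower_bound_posdefs)
    have "\<bar>s\<bar> * norm H \<le> \<bar>s\<bar> * (norm H + 1)" by (intro mult_left_mono) auto
    also have "\<bar>s\<bar> * (norm H + 1) < \<delta> * (norm H + 1)"
      using that by (intro mult_strict_right_mono) (auto simp: add_nonneg_pos)
    also have "\<dots> = a" by (simp add: \<delta>_def add_nonneg_eq_0_iff)
    finally show "0 < a - \<bar>s\<bar> * norm H" by simp
    show "(a - \<bar>s\<bar> * norm H) *\<^sub>R mat 1 \<le>\<^sub>L X + s *\<^sub>R H"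
      using H posdefs_adj[OF X]
      by (intro lower_bound_perturb[OF a(2)]) (auto simp: hermitian_def adj_add adj_scaleR)
  qed
  have "((\<lambda>s. X + s *\<^sub>R H) has_derivative (\<lambda>s. s *\<^sub>R H)) (at 0 within ?I)"
    by (auto intro!: derivative_eq_intros)
  moreover have "((\<lambda>Y. 0::real) has_derivative hs_inner H) (at (X + 0 *\<^sub>R H) within (\<lambda>s. X + s *\<^sub>R H) ` ?I)"
    using zero by (rule_tac has_derivative_subset) (use path in auto)
  ultimately have "((\<lambda>s. 0::real) has_derivative (\<lambda>s. hs_inner H (s *\<^sub>R H))) (at 0 within ?I)"
    by (rule has_derivative_in_compose[where g = "\<lambda>_. 0"])
  then have "((\<lambda>s. 0::real) has_derivative (\<lambda>s. hs_inner H (s *\<^sub>R H))) (at 0)"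
    using \<delta> by (subst (asm) at_within_open) auto
  from has_derivative_unique[OF this has_derivative_const] have "hs_inner H (1 *\<^sub>R H) = 0"
    by meson
  then have "H = 0" using H by (simp add: hs_inner_hermitian)
  then show "G' = G" by (simp add: H_def)
qed

text \<open>The mean value theorem for the difference of both sides along the segment from \<open>X\<close> to \<open>Y\<close>: monotonicity makes its derivative nonnegative.\<close>
lemma strongly_convex_of_strongly_monotone_gradient:
  fixes g :: "complex^'n^'n \<Rightarrow> complex^'n^'n"
  assumes K: "convex K" "K \<subseteq> posdefs"
    and der: "\<And>X. X \<in> posdefs \<Longrightarrow> (f has_derivative hs_inner (g X)) (at X within posdefs)"
    and mono: "\<And>X Y. X \<in> K \<Longrightarrow> Y \<in> K \<Longrightarrow> k * (norm (Y - X))\<^sup>2 \<le> hs_inner (g Y - g X) (Y - X)"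
    and X: "X \<in> K" and Y: "Y \<in> K"
  shows "f Y \<ge> f X + hs_inner (g X) (Y - X) + k / 2 * (norm (X - Y))\<^sup>2"
proof -
  define H where "H = Y - X"
  define p where "p = (\<lambda>s::real. X + s *\<^sub>R H)"
  have pK: "p s \<in> K" if "s \<in> {0..1}" for s
    using convexD_alt[OF K(1) X Y, of s] that by (simp add: p_def H_def algebra_simps)
  define h where "h = (\<lambda>s. f (p s) - s * hs_inner (g X) H - k / 2 * s\<^sup>2 * (norm H)\<^sup>2)"
  define h' where "h' = (\<lambda>s u. hs_inner (g (p s)) (u *\<^sub>R H) - u * hs_inner (g X) H - k * s * u * (norm H)\<^sup>2)"
  have "(h has_derivative h' s) (at s within {0..1})" if "0 \<le> s" "s \<le> 1" for s
  proof -
    have "(p has_derivative (\<lambda>u. u *\<^sub>R H)) (at s within {0..1})"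
      unfolding p_def by (auto intro!: derivative_eq_intros)
    moreover have "(f has_derivative hs_inner (g (p s))) (at (p s) within p ` {0..1})"
      using pK K(2) that by (intro has_derivative_subset[OF der]) auto
    ultimately have "((\<lambda>s. f (p s)) has_derivative (\<lambda>u. hs_inner (g (p s)) (u *\<^sub>R H))) (at s within {0..1})"
      by (rule has_derivative_in_compose)
    then show ?thesis
      unfolding h_def h'_def by (auto intro!: derivative_eq_intros simp: fun_eq_iff)
  qed
  then obtain s where s: "s \<in> {0<..<1}" "h 1 - h 0 = h' s (1 - 0)"
    using mvt_simple[of 0 1 h h'] by auto
  have "k * (norm (p s - X))\<^sup>2 \<le> hs_inner (g (p s) - g X) (p s - X)"
    using s pK[of s] by (intro mono X) auto
  then have "s * (k * s * (norm H)\<^sup>2) \<le> s * (hs_inner (g (p s) - g X) H)"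
    by (simp add: p_def hs_inner_eq_inner power_mult_distrib power2_eq_square mult_ac)
  then have "k * s * (norm H)\<^sup>2 \<le> hs_inner (g (p s) - g X) H"
    using s by simp
  then have "0 \<le> h 1 - h 0"
    unfolding s(2) by (simp add: h'_def hs_inner_eq_inner adj_diff inner_diff_left)
  then show ?thesis
    by (simp add: h_def p_def H_def norm_minus_commute)
qed

section \<open>Order intervals and exponents\<close>

text \<open>The exponents fit together: with \<open>C = A powr s\<close> and \<open>D = A powr (- 2 s)\<close>, a bound \<open>c\<close> on \<open>A\<close> enters the estimates above
  as \<open>d = c powr (- 2 s)\<close>, raised to the power \<open>r - 1 = - t\<close>, and this is \<open>c powr (1 - t)\<close>.\<close>
lemma half_weight_properties:
  assumes t: "0 < t" "t < 1" and A: "A \<in> posdefs"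
  defines "s \<equiv> (1 - t) / (2 * t)"
  shows "mat_powr A s ** mat_powr A (- 2 * s) ** mat_powr A s = mat 1"
    and "0 < b \<Longrightarrow> A \<le>\<^sub>L b *\<^sub>R mat 1 \<Longrightarrow> (b powr (- 2 * s)) *\<^sub>R mat 1 \<le>\<^sub>L mat_powr A (- 2 * s)"
    and "0 < a \<Longrightarrow> a *\<^sub>R mat 1 \<le>\<^sub>L A \<Longrightarrow> mat_powr A (- 2 * s) \<le>\<^sub>L (a powr (- 2 * s)) *\<^sub>R mat 1"
    and "(c powr (- 2 * s)) powr ((1 - t) - 1) = c powr (1 - t)"
proof -
  show "mat_powr A s ** mat_powr A (- 2 * s) ** mat_powr A s = mat 1"
    using A by (simp add: mat_powr_mult mat_powr_0)
  have e: "- 2 * s = - ((1 - t) / t)" using t by (simp add: s_def field_simps)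
  have "- 2 * s \<le> 0" using t unfolding e by simp
  then show "0 < b \<Longrightarrow> A \<le>\<^sub>L b *\<^sub>R mat 1 \<Longrightarrow> (b powr (- 2 * s)) *\<^sub>R mat 1 \<le>\<^sub>L mat_powr A (- 2 * s)"
    and "0 < a \<Longrightarrow> a *\<^sub>R mat 1 \<le>\<^sub>L A \<Longrightarrow> mat_powr A (- 2 * s) \<le>\<^sub>L (a powr (- 2 * s)) *\<^sub>R mat 1"
    using mat_powr_lower_bound_neg mat_powr_upper_bound_neg A by blast+
  have "- 2 * s * ((1 - t) - 1) = 1 - t" using t unfolding e by simp
  then show "(c powr (- 2 * s)) powr ((1 - t) - 1) = c powr (1 - t)"
    by (simp only: powr_powr)
qed

definition loewner_interval :: "real \<Rightarrow> real \<Rightarrow> (complex^'n^'n) set" where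
  "loewner_interval a b = {X. a *\<^sub>R mat 1 \<le>\<^sub>L X \<and> X \<le>\<^sub>L b *\<^sub>R mat 1}"

lemma loewner_interval_posdefs: "0 < a \<Longrightarrow> loewner_interval a b \<subseteq> posdefs"
  by (auto simp: loewner_interval_def intro: lower_bound_posdefs)

text \<open>This form exhibits the interval as an intersection of closed sets.\<close>
lemma loewner_interval_eq: "loewner_interval a b = {X. hermitian X} \<inter> (\<Inter>v. {X. a * (norm v)\<^sup>2 \<le> qform X v} \<inter> {X. qform X v \<le> b * (norm v)\<^sup>2})"
  by (auto simp: loewner_interval_def loewner_lower_iff loewner_upper_iff)

lemma convex_loewner_interval: "convex (loewner_interval a b)"
proof (rule convexI)
  fix X Y :: "complex^'n^'n" and u v :: real
  assume X: "X \<in> loewner_interval a b" and Y: "Y \<in> loewner_interval a b" and u: "0 \<le> u" "0 \<le> v" "u + v = 1"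
  have "a * (norm x)\<^sup>2 \<le> u * qform X x + v * qform Y x \<and> u * qform X x + v * qform Y x \<le> b * (norm x)\<^sup>2" for x
    using X Y u convex_bound_le[of "qform X x" "b * (norm x)\<^sup>2" "qform Y x" u v]
     convex_bound_le[of "- qform X x" "- (a * (norm x)\<^sup>2)" "- qform Y x" u v]
    by (auto simp: loewner_interval_def loewner_lower_iff loewner_upper_iff)
  then show "u *\<^sub>R X + v *\<^sub>R Y \<in> loewner_interval a b"
    using X Y by (auto simp: loewner_interval_def loewner_lower_iff loewner_upper_iff hermitian_def adj_add adj_scaleR
        qform_add qform_scaleR)
qed

lemma compact_loewner_interval: "compact (loewner_interval a b :: (complex^'n^'n) set)"
proof (rule compact_eq_bounded_closed[THEN iffD2], intro conjI)
  have cq: "continuous_on UNIV (\<lambda>X :: complex^'n^'n. qform X v)" for v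
    by (rule linear_continuous_on) (simp add: linear_qform flip: linear_conv_bounded_linear)
  have ca: "continuous_on UNIV (adj :: complex^'n^'n \<Rightarrow> _)"
    by (rule linear_continuous_on) (simp add: linear_adj flip: linear_conv_bounded_linear)
  have "closed {X :: complex^'n^'n. hermitian X}"
    unfolding hermitian_def by (rule closed_Collect_eq[OF ca continuous_on_id])
  moreover have "closed {X :: complex^'n^'n. a * (norm v)\<^sup>2 \<le> qform X v}"
    "closed {X :: complex^'n^'n. qform X v \<le> b * (norm v)\<^sup>2}" for v
    by (rule closed_Collect_le[OF continuous_on_const cq], rule closed_Collect_le[OF cq continuous_on_const])
  ultimately show "closed (loewner_interval a b :: (complex^'n^'n) set)"
    unfolding loewner_interval_eq by (intro closed_Int closed_INT ballI)
  have "norm X \<le> max \<bar>a\<bar> \<bar>b\<bar> * norm (mat 1 :: complex^'n^'n)" if X: "X \<in> loewner_interval a b" for X :: "complex^'n^'n"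
  proof -
    have "hermitian X" using X by (simp add: loewner_interval_def loewner_lower_iff)
    then obtain U d where U: "unitary U" and Xs: "X = spectral U d" by (rule hermitian_spectral)
    have "\<bar>d i\<bar> \<le> max \<bar>a\<bar> \<bar>b\<bar>" for i
    proof -
      have "a \<le> d i" "d i \<le> b"
        using X U by (simp_all add: Xs loewner_interval_def spectral_lower_bound_iff spectral_upper_bound_iff)
      then show ?thesis by linarith
    qed
    from norm_spectral_mult_le[OF U this, where H = "mat 1"] show ?thesis by (simp add: Xs)
  qed
  then show "bounded (loewner_interval a b :: (complex^'n^'n) set)"
    unfolding bounded_iff by blast
qed

lemma common_loewner_interval:
  assumes "finite S" "S \<subseteq> posdefs"
  obtains a b where "0 < a" "0 < b" "S \<subseteq> loewner_interval a b"
proof -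
  have "\<exists>a b. 0 < a \<and> 0 < b \<and> S \<subseteq> loewner_interval a b" using assms
  proof (induction S)
    case empty then show ?case by (auto intro: exI[of _ 1])
  next
    case (insert X S)
    then obtain a b where S: "0 < a" "0 < b" "S \<subseteq> loewner_interval a b" by auto
    have "X \<in> posdefs" using insert by simp
    then obtain a' b' where X: "0 < a'" "0 < b'" "a' *\<^sub>R mat 1 \<le>\<^sub>L X" "X \<le>\<^sub>L b' *\<^sub>R mat 1"
      using posdefs_bounds by blast
    have "insert X S \<subseteq> loewner_interval (min a a') (max b b')"
      using S X unfolding loewner_interval_def by (auto intro: lower_bound_mono upper_bound_mono)
    then show ?case using S X by (intro exI[of _ "min a a'"] exI[of _ "max b b'"]) auto
  qed
  then show ?thesis using that by blast
qed

section \<open>The objective function\<close>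
locale weighted_family =
  fixes t :: real and m :: nat and w :: "nat \<Rightarrow> real" and A :: "nat \<Rightarrow> complex^'n^'n"
  assumes t: "0 < t" "t < 1"
    and A: "\<And>j. j \<in> {1..m} \<Longrightarrow> A j \<in> posdefs"
    and w: "\<And>j. j \<in> {1..m} \<Longrightarrow> 0 < w j"
    and w_sum: "(\<Sum>j=1..m. w j) = 1"
begin

definition half_power :: "nat \<Rightarrow> complex^'n^'n" where
  "half_power j = mat_powr (A j) ((1 - t) / (2 * t))"

definition grad :: "complex^'n^'n \<Rightarrow> complex^'n^'n" where
  "grad X = (\<Sum>j=1..m. (w j * t) *\<^sub>R (mat 1 - sandwich_power (1 - t) (half_power j) X))"

lemma half_power_posdefs: "j \<in> {1..m} \<Longrightarrow> half_power j \<in> posdefs"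
  by (simp add: half_power_def mat_powr_posdefs A)

lemma phi_eq: "phi t m w A X = (\<Sum>j=1..m. w j *
    (Re (trace ((1 - t) *\<^sub>R A j + t *\<^sub>R X)) - sandwich_trace t (half_power j) X))"
  by (simp add: phi_def sandwich_trace_def half_power_def)

lemma hs_inner_grad:
  "hs_inner (grad X) H = (\<Sum>j=1..m. w j * (t * Re (trace H) - t * hs_inner (sandwich_power (1 - t) (half_power j) X) H))"
  unfolding grad_def hs_inner_commute[of _ H]
  by (simp add: hs_inner_eq_inner inner_sum_right inner_diff_right algebra_simps)
    (simp add: hs_inner_def flip: hs_inner_eq_inner)

lemma phi_has_gradient:
  assumes X: "X \<in> posdefs"
  shows "has_gradient (phi t m w A) (grad X) X"
  unfolding has_gradient_def
proof
  have "adj (grad X) = grad X"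
    using posdefs_adj[OF sandwich_power_posdefs[OF half_power_posdefs X]]
    by (simp add: grad_def linear_sum[OF linear_adj] adj_scaleR adj_diff)
  then show "hermitian (grad X)" by (simp add: hermitian_def)
  have tr: "((\<lambda>Y. Re (trace ((1 - t) *\<^sub>R B + t *\<^sub>R Y))) has_derivative (\<lambda>H. t * Re (trace H)))
      (at X within posdefs)" for B :: "complex^'n^'n"
  proof -
    have "linear (\<lambda>H :: complex^'n^'n. Re (trace H))"
      using Re_trace_affine[of 1 _ 1] Re_trace_affine[of _ _ 0 0] by (intro linearI) auto
    then have "((\<lambda>H. Re (trace H)) has_derivative (\<lambda>H. Re (trace H))) (at X within posdefs)"
      by (intro bounded_linear_imp_has_derivative) (simp add: linear_conv_bounded_linear)
    then show ?thesis unfolding Re_trace_affine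
      by (intro has_derivative_eq_rhs[OF has_derivative_add[OF has_derivative_const has_derivative_mult_right]]) auto
  qed
  have "hs_inner (grad X) = (\<lambda>H. \<Sum>j=1..m. w j * (t * Re (trace H) - t * hs_inner (sandwich_power (1 - t) (half_power j) X) H))"
    by (simp add: fun_eq_iff hs_inner_grad)
  then show "(phi t m w A has_derivative hs_inner (grad X)) (at X within posdefs)"
    unfolding phi_eq[abs_def] using X
    by (auto intro!: has_derivative_sum has_derivative_mult_right has_derivative_diff tr
        has_derivative_sandwich_trace t half_power_posdefs)
qed

lemma gradient_phi: "X \<in> posdefs \<Longrightarrow> gradient (phi t m w A) X = grad X"
  by (rule gradient_eqI[OF _ phi_has_gradient])

lemma phi_tangent:
  assumes X: "X \<in> posdefs" and Y: "Y \<in> posdefs"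
  shows "phi t m w A X + hs_inner (grad X) (Y - X) \<le> phi t m w A Y"
  unfolding phi_eq hs_inner_grad sum.distrib[symmetric] distrib_left[symmetric]
proof (intro sum_mono mult_left_mono)
  fix j assume j: "j \<in> {1..m}"
  show "0 \<le> w j" using w[OF j] by simp
  show "Re (trace ((1 - t) *\<^sub>R A j + t *\<^sub>R X)) - sandwich_trace t (half_power j) X
      + (t * Re (trace (Y - X)) - t * hs_inner (sandwich_power (1 - t) (half_power j) X) (Y - X))
    \<le> Re (trace ((1 - t) *\<^sub>R A j + t *\<^sub>R Y)) - sandwich_trace t (half_power j) Y"
    using sandwich_trace_tangent[OF t half_power_posdefs[OF j] X Y] unfolding Re_trace_affine
    by (simp add: trace_sub algebra_simps)
qed

text \<open>Since \<open>C\<^sub>j A\<^sub>j C\<^sub>j = A\<^sub>j powr (1 / t)\<close>, each summand vanishes at \<open>X = A\<^sub>j\<close> together with its gradient. The tangent inequality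
  at this point is the claim.\<close>
lemma phi_nonneg:
  assumes X: "X \<in> posdefs"
  shows "0 \<le> phi t m w A X"
  unfolding phi_eq
proof (intro sum_nonneg mult_nonneg_nonneg)
  fix j assume j: "j \<in> {1..m}"
  show "0 \<le> w j" using w[OF j] by simp
  let ?s = "(1 - t) / (2 * t)"
  have Aj: "A j \<in> posdefs" by (rule A[OF j])
  have "half_power j ** A j ** half_power j = mat_powr (A j) (?s + 1 + ?s)"
    using Aj mat_powr_mult[OF Aj, of ?s 1] by (simp add: half_power_def mat_powr_1 mat_powr_mult)
  also have "?s + 1 + ?s = 1 / t" using t by (simp add: field_simps)
  finally have rAr: "half_power j ** A j ** half_power j = mat_powr (A j) (1 / t)" .
  have "sandwich_power (1 - t) (half_power j) (A j) = mat_powr (A j) (?s + (1 / t) * (- (1 - t)) + ?s)"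
    using Aj by (simp only: sandwich_power_def rAr) (simp add: half_power_def mat_powr_powr mat_powr_mult)
  also have "?s + (1 / t) * (- (1 - t)) + ?s = 0" using t by (simp add: field_simps)
  finally have p: "sandwich_power (1 - t) (half_power j) (A j) = mat 1" using Aj by (simp add: mat_powr_0)
  have st: "sandwich_trace t (half_power j) (A j) = Re (trace (A j))"
    using t Aj by (simp add: sandwich_trace_def rAr mat_powr_powr mat_powr_1)
  have i: "hs_inner (mat 1) (X - A j) = Re (trace X) - Re (trace (A j))"
    by (simp add: hs_inner_def trace_sub)
  show "0 \<le> Re (trace ((1 - t) *\<^sub>R A j + t *\<^sub>R X)) - sandwich_trace t (half_power j) X"
    using sandwich_trace_tangent[OF t half_power_posdefs[OF j] Aj X]
    unfolding p st i Re_trace_affine by (simp add: algebra_simps)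
qed

lemma grad_lipschitz:
  assumes a: "0 < a" and b: "0 < b" and AK: "\<And>j. j \<in> {1..m} \<Longrightarrow> A j \<in> loewner_interval a b"
    and X: "X \<in> loewner_interval a b" and Y: "Y \<in> loewner_interval a b"
  shows "norm (grad X - grad Y) \<le> t * (1 - t) * b powr (1 - t) * a powr (t - 2) * norm (X - Y)"
proof -
  let ?p = "\<lambda>j X. sandwich_power (1 - t) (half_power j) X"
  define L where "L = (1 - t) * b powr (1 - t) * a powr (t - 2)"
  have lip: "norm (?p j X - ?p j Y) \<le> L * norm (X - Y)" if j: "j \<in> {1..m}" for j
  proof -
    note half = half_weight_properties[OF t A[OF j], folded half_power_def]
    have "norm (?p j X - ?p j Y) \<le> (1 - t) *
       (b powr (- 2 * ((1 - t) / (2 * t)))) powr ((1 - t) - 1) * a powr (- (1 - t) - 1) * norm (X - Y)"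
      using t a X Y AK[OF j] b
      by (intro sandwich_power_lipschitz[OF _ _ half_power_posdefs[OF j] half(1)] half(2)) (auto simp: loewner_interval_def)
    also have "- (1 - t) - 1 = t - 2" by simp
    finally show ?thesis unfolding L_def half(4) .
  qed
  have "grad X - grad Y = (\<Sum>j=1..m. (w j * t) *\<^sub>R (?p j Y - ?p j X))"
    by (simp add: grad_def sum_subtractf[symmetric] scaleR_diff_right[symmetric])
  also have "norm \<dots> \<le> (\<Sum>j=1..m. w j * (t * L * norm (X - Y)))"
  proof (rule sum_norm_le)
    fix j assume j: "j \<in> {1..m}"
    have "(w j * t) * norm (?p j X - ?p j Y) \<le> (w j * t) * (L * norm (X - Y))"
      using lip[OF j] w[OF j] t by (intro mult_left_mono) auto
    then show "norm ((w j * t) *\<^sub>R (?p j Y - ?p j X)) \<le> w j * (t * L * norm (X - Y))"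
      using w[OF j] t by (simp add: norm_minus_commute mult.assoc)
  qed
  also have "\<dots> = t * L * norm (X - Y)"
    by (simp add: w_sum[simplified] flip: sum_distrib_right)
  finally show ?thesis by (simp add: L_def mult.assoc)
qed

lemma grad_strongly_monotone:
  assumes a: "0 < a" and b: "0 < b" and AK: "\<And>j. j \<in> {1..m} \<Longrightarrow> A j \<in> loewner_interval a b"
    and X: "X \<in> loewner_interval a b" and Y: "Y \<in> loewner_interval a b"
  shows "t * (1 - t) * b powr (t - 2) * a powr (1 - t) * (norm (Y - X))\<^sup>2 \<le> hs_inner (grad Y - grad X) (Y - X)"
proof -
  let ?p = "\<lambda>j X. sandwich_power (1 - t) (half_power j) X"
  define L where "L = (1 - t) * b powr (t - 2) * a powr (1 - t)"
  have P: "X \<in> posdefs" "Y \<in> posdefs" using X Y loewner_interval_posdefs[OF a] by auto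
  have mono: "L * (norm (Y - X))\<^sup>2 \<le> hs_inner (?p j X - ?p j Y) (Y - X)" if j: "j \<in> {1..m}" for j
  proof -
    note half = half_weight_properties[OF t A[OF j], folded half_power_def]
    have "(1 - t) * (a powr (- 2 * ((1 - t) / (2 * t)))) powr ((1 - t) - 1) * b powr (- (1 - t) - 1)
        * (norm (Y - X))\<^sup>2 \<le> hs_inner (Y - X) (?p j X - ?p j Y)"
      using t a X Y AK[OF j] b P
      by (intro sandwich_power_strongly_antitone[OF _ _ half_power_posdefs[OF j] half(1)] half(3) mat_powr_posdefs A j)
        (auto simp: loewner_interval_def)
    also have "- (1 - t) - 1 = t - 2" by simp
    finally show ?thesis unfolding L_def half(4) by (simp add: hs_inner_commute mult_ac)
  qed
  have "t * L * (norm (Y - X))\<^sup>2 = (\<Sum>j=1..m. w j * (t * L * (norm (Y - X))\<^sup>2))"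
    by (simp add: w_sum[simplified] flip: sum_distrib_right)
  also have "\<dots> \<le> (\<Sum>j=1..m. w j * (t * hs_inner (?p j X - ?p j Y) (Y - X)))"
    using mono w t by (intro sum_mono mult_left_mono) (auto simp: mult.assoc intro: less_imp_le)
  also have "\<dots> = hs_inner (grad Y) (Y - X) - hs_inner (grad X) (Y - X)"
    unfolding hs_inner_grad sum_subtractf[symmetric]
    by (intro sum.cong refl) (simp add: hs_inner_eq_inner adj_diff inner_diff_left algebra_simps)
  also have "\<dots> = hs_inner (grad Y - grad X) (Y - X)"
    by (simp add: hs_inner_eq_inner adj_diff inner_diff_left)
  finally show ?thesis by (simp add: L_def mult_ac)
qed

lemma phi_strongly_convex:
  assumes a: "0 < a" and b: "0 < b" and AK: "\<And>j. j \<in> {1..m} \<Longrightarrow> A j \<in> loewner_interval a b"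
    and X: "X \<in> loewner_interval a b" and Y: "Y \<in> loewner_interval a b"
  shows "phi t m w A Y \<ge> phi t m w A X + hs_inner (grad X) (Y - X)
    + t * (1 - t) * b powr (t - 2) * a powr (1 - t) / 2 * (norm (X - Y))\<^sup>2"
proof (rule strongly_convex_of_strongly_monotone_gradient[OF convex_loewner_interval loewner_interval_posdefs[OF a] _ _ X Y])
  show "(phi t m w A has_derivative hs_inner (grad Z)) (at Z within posdefs)" if "Z \<in> posdefs" for Z
    using phi_has_gradient[OF that] by (simp add: has_gradient_def)
qed (rule grad_strongly_monotone[OF a b AK])

text \<open>Two given points lie, together with all \<open>A j\<close>, in some order interval, on which the function is strongly convex. The strong convexity inequality
  at the intermediate point, averaged over the two end points, loses its linear term and keeps a positive quadratic one.\<close>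
lemma phi_strictly_convex: "strictly_convex_on posdefs (phi t m w A)"
  unfolding strictly_convex_on_def
proof (intro conjI convex_posdefs ballI allI impI)
  let ?f = "phi t m w A"
  fix X Y :: "complex^'n^'n" and u :: real
  assume P: "X \<in> posdefs" "Y \<in> posdefs" and *: "X \<noteq> Y \<and> 0 < u \<and> u < 1"
  have "insert X (insert Y (A ` {1..m})) \<subseteq> posdefs" using P A by auto
  then obtain a b where a: "0 < a" and b: "0 < b" and sub: "insert X (insert Y (A ` {1..m})) \<subseteq> loewner_interval a b"
    using common_loewner_interval[of "insert X (insert Y (A ` {1..m}))"] by auto
  define k where "k = t * (1 - t) * b powr (t - 2) * a powr (1 - t)"
  have k: "0 < k" using t a b by (simp add: k_def)
  define Z where "Z = (1 - u) *\<^sub>R X + u *\<^sub>R Y"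
  have AK: "A j \<in> loewner_interval a b" if "j \<in> {1..m}" for j using sub that by auto
  have XY: "X \<in> loewner_interval a b" "Y \<in> loewner_interval a b" using sub by auto
  then have Z: "Z \<in> loewner_interval a b" unfolding Z_def using * by (intro convexD_alt[OF convex_loewner_interval]) auto
  have sc: "?f W \<ge> ?f Z + hs_inner (grad Z) (W - Z) + k / 2 * (norm (Z - W))\<^sup>2" if "W \<in> loewner_interval a b" for W
    using phi_strongly_convex[OF a b AK Z that] by (simp add: k_def)
  have XZ: "X - Z = u *\<^sub>R (X - Y)" and YZ: "Y - Z = (u - 1) *\<^sub>R (X - Y)"
    by (simp_all add: Z_def algebra_simps)
  have "Z \<noteq> X" using XZ * by auto
  have i: "(1 - u) * hs_inner (grad Z) (X - Z) + u * hs_inner (grad Z) (Y - Z) = 0"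
    unfolding XZ YZ hs_inner_eq_inner inner_scaleR_right by algebra
  have "0 < (1 - u) * (k / 2 * (norm (Z - X))\<^sup>2)"
    using * k \<open>Z \<noteq> X\<close> by simp
  moreover have "0 \<le> u * (k / 2 * (norm (Z - Y))\<^sup>2)"
    using * k by simp
  moreover have "(1 - u) * (?f Z + hs_inner (grad Z) (X - Z) + k / 2 * (norm (Z - X))\<^sup>2)
     + u * (?f Z + hs_inner (grad Z) (Y - Z) + k / 2 * (norm (Z - Y))\<^sup>2) \<le> (1 - u) * ?f X + u * ?f Y"
    using sc XY * by (intro add_mono mult_left_mono) auto
  moreover have "(1 - u) * (?f Z + x + p) + u * (?f Z + y + q)
      = ?f Z + ((1 - u) * x + u * y) + (1 - u) * p + u * q" for x y p q :: real
    by algebra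
  ultimately have "?f Z < (1 - u) * ?f X + u * ?f Y"
    using i by (smt (verit))
  then show "?f ((1 - u) *\<^sub>R X + u *\<^sub>R Y) < (1 - u) * ?f X + u * ?f Y"
    by (simp add: Z_def)
qed

lemma qform_grad: "norm v = 1 \<Longrightarrow> qform (grad X) v = (\<Sum>j=1..m. (w j * t) * (1 - qform (sandwich_power (1 - t) (half_power j) X) v))"
  unfolding grad_def by (simp add: linear_sum[OF linear_qform] qform_scaleR qform_diff qform_mat_1[of 1, simplified])

text \<open>If all \<open>A j\<close> are at least \<open>a\<close>, then at a point with eigenvalue \<open>a\<close> the function does not increase
  to first order when this eigenvalue grows: the exponents \<open>1 - t\<close> of the bound on \<open>A j\<close> and \<open>- (1 - t)\<close> of the eigenvalue cancel.\<close>
lemma grad_eigen_nonpos: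
  assumes a: "0 < a" and AK: "\<And>j. j \<in> {1..m} \<Longrightarrow> a *\<^sub>R mat 1 \<le>\<^sub>L A j"
    and X: "X \<in> posdefs" and v: "norm v = 1" "X *v v = a *\<^sub>R v"
  shows "qform (grad X) v \<le> 0"
  unfolding qform_grad[OF v(1)]
proof (intro sum_nonpos mult_nonneg_nonpos)
  fix j assume j: "j \<in> {1..m}"
  show "0 \<le> w j * t" using w[OF j] t by simp
  note half = half_weight_properties[OF t A[OF j], folded half_power_def]
  have "(a powr (- 2 * ((1 - t) / (2 * t)))) powr ((1 - t) - 1) * a powr (- (1 - t))
      \<le> qform (sandwich_power (1 - t) (half_power j) X) v"
    using t a X v AK[OF j]
    by (intro qform_sandwich_power_ge[OF _ _ half_power_posdefs[OF j] half(1)] half(3) mat_powr_posdefs A j) auto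
  then show "1 - qform (sandwich_power (1 - t) (half_power j) X) v \<le> 0"
    unfolding half(4) using a by (simp flip: powr_add)
qed

lemma grad_eigen_nonneg:
  assumes b: "0 < b" and AK: "\<And>j. j \<in> {1..m} \<Longrightarrow> A j \<le>\<^sub>L b *\<^sub>R mat 1"
    and X: "X \<in> posdefs" and v: "norm v = 1" "X *v v = b *\<^sub>R v"
  shows "0 \<le> qform (grad X) v"
  unfolding qform_grad[OF v(1)]
proof (intro sum_nonneg mult_nonneg_nonneg)
  fix j assume j: "j \<in> {1..m}"
  show "0 \<le> w j" "0 \<le> t" using w[OF j] t by simp_all
  note half = half_weight_properties[OF t A[OF j], folded half_power_def]
  have "qform (sandwich_power (1 - t) (half_power j) X) v
      \<le> (b powr (- 2 * ((1 - t) / (2 * t)))) powr ((1 - t) - 1) * b powr (- (1 - t))"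
    using t b X v AK[OF j]
    by (intro qform_sandwich_power_le[OF _ _ half_power_posdefs[OF j] half(1)] half(2)) auto
  then show "0 \<le> 1 - qform (sandwich_power (1 - t) (half_power j) X) v"
    unfolding half(4) using b by (simp flip: powr_add)
qed

text \<open>Clamping the eigenvalues of \<open>X\<close> to \<open>[a, b]\<close> yields \<open>Y\<close> with the same eigenvectors. By convexity it suffices that
  \<open>\<langle>grad Y, X - Y\<rangle> \<ge> 0\<close>, and this is a sum over the eigenvalues that were changed. Each of them was moved to \<open>a\<close> or \<open>b\<close>,
  where the sign of the gradient in the direction of the eigenvector is known.\<close>
lemma phi_clamp_le:
  assumes a: "0 < a" and ab: "a \<le> b" and AK: "\<And>j. j \<in> {1..m} \<Longrightarrow> A j \<in> loewner_interval a b" and X: "X \<in> posdefs"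
  shows "\<exists>Y\<in>loewner_interval a b. phi t m w A Y \<le> phi t m w A X"
proof -
  obtain U d where U: "unitary U" and Xs: "X = spectral U d" and d: "\<And>i. 0 < d i"
    using posdefs_spectral[OF X] by blast
  define c where "c = (\<lambda>i. max a (min b (d i)))"
  define Y where "Y = spectral U c"
  have Y: "Y \<in> loewner_interval a b"
    using U ab by (simp add: Y_def loewner_interval_def spectral_lower_bound_iff spectral_upper_bound_iff c_def)
  then have YP: "Y \<in> posdefs" using loewner_interval_posdefs[OF a] by blast
  have AK': "a *\<^sub>R mat 1 \<le>\<^sub>L A j" "A j \<le>\<^sub>L b *\<^sub>R mat 1" if "j \<in> {1..m}" for j
    using AK[OF that] by (simp_all add: loewner_interval_def)
  have b: "0 < b" using a ab by simp
  have "hs_inner (grad Y) (X - Y) = (\<Sum>i\<in>UNIV. (d i - c i) * qform (grad Y) (column i U))"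
    by (simp add: Xs Y_def spectral_diff hs_inner_spectral)
  also have "\<dots> \<ge> 0"
  proof (rule sum_nonneg)
    fix i
    have v: "norm (column i U) = 1" "Y *v column i U = c i *\<^sub>R column i U"
      using U by (simp_all add: norm_column_unitary Y_def spectral_mult_column)
    consider "d i < a" | "b < d i" | "a \<le> d i" "d i \<le> b" by linarith
    then show "0 \<le> (d i - c i) * qform (grad Y) (column i U)"
    proof cases
      case 1
      then have "c i = a" using ab by (simp add: c_def)
      then show ?thesis
        using 1 v grad_eigen_nonpos[OF a AK'(1) YP] by (intro mult_nonpos_nonpos) auto
    next
      case 2
      then have "c i = b" using ab by (simp add: c_def)
      then show ?thesis
        using 2 v grad_eigen_nonneg[OF b AK'(2) YP] by (intro mult_nonneg_nonneg) auto
    next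
      case 3
      then show ?thesis by (simp add: c_def)
    qed
  qed
  finally show ?thesis using phi_tangent[OF YP X] Y by (intro bexI[of _ Y]) auto
qed

text \<open>By clamping, a minimiser over the compact interval is a global one.\<close>
lemma phi_minimiser_exists:
  assumes a: "0 < a" and AK: "\<And>j. j \<in> {1..m} \<Longrightarrow> A j \<in> loewner_interval a b"
  shows "\<exists>X\<in>posdefs. \<forall>Y\<in>posdefs. phi t m w A X \<le> phi t m w A Y"
proof -
  have "m \<noteq> 0"
  proof
    assume "m = 0"
    with w_sum show False by simp
  qed
  then have "1 \<in> {1..m}" by simp
  then have A1: "A 1 \<in> loewner_interval a b" by (rule AK)
  have ab: "a \<le> b"
  proof -
    obtain U d where U: "unitary U" and A1s: "A 1 = spectral U d"
      using posdefs_spectral[OF A[OF \<open>1 \<in> {1..m}\<close>]] by blast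
    have "a \<le> d undefined" "d undefined \<le> b"
      using A1 spectral_lower_bound_iff[OF U] spectral_upper_bound_iff[OF U]
      unfolding A1s loewner_interval_def by blast+
    then show ?thesis by linarith
  qed
  have "continuous_on (loewner_interval a b) (phi t m w A)"
  proof (rule continuous_on_subset[OF _ loewner_interval_posdefs[OF a]])
    show "continuous_on posdefs (phi t m w A)"
      unfolding continuous_on_eq_continuous_within
    proof
      fix X :: "complex^'n^'n" assume "X \<in> posdefs"
      then show "continuous (at X within posdefs) (phi t m w A)"
        using phi_has_gradient has_derivative_continuous unfolding has_gradient_def by blast
    qed
  qed
  then obtain X where X: "X \<in> loewner_interval a b" and min: "\<And>Y. Y \<in> loewner_interval a b \<Longrightarrow> phi t m w A X \<le> phi t m w A Y"
    using continuous_attains_inf[OF compact_loewner_interval, of a b "phi t m w A"] A1 by blast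
  have "phi t m w A X \<le> phi t m w A Y" if "Y \<in> posdefs" for Y
    using phi_clamp_le[OF a ab AK that] min by force
  then show ?thesis using X loewner_interval_posdefs[OF a] by blast
qed

lemma phi_unique_minimiser:
  assumes a: "0 < a" and AK: "\<And>j. j \<in> {1..m} \<Longrightarrow> A j \<in> loewner_interval a b"
  shows "\<exists>!X. is_arg_min (phi t m w A) (\<lambda>X. X \<in> posdefs) X"
proof -
  let ?f = "phi t m w A"
  obtain X where X: "X \<in> posdefs" "\<And>Y. Y \<in> posdefs \<Longrightarrow> ?f X \<le> ?f Y"
    using phi_minimiser_exists[OF a AK] by blast
  show ?thesis
  proof (rule ex1I)
    show "is_arg_min ?f (\<lambda>X. X \<in> posdefs) X"
      using X by (auto simp: is_arg_min_linorder)
    fix Y assume "is_arg_min ?f (\<lambda>X. X \<in> posdefs) Y"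
    then have Y: "Y \<in> posdefs" "?f Y \<le> ?f X" using X(1) by (auto simp: is_arg_min_linorder)
    show "Y = X"
    proof (rule ccontr)
      assume "Y \<noteq> X"
      define M where "M = (1 - 1/2) *\<^sub>R Y + (1/2) *\<^sub>R X"
      have "?f M < (1 - 1/2) * ?f Y + (1/2) * ?f X"
        using phi_strictly_convex[unfolded strictly_convex_on_def, THEN conjunct2, rule_format, OF Y(1) X(1), of "1/2"]
          \<open>Y \<noteq> X\<close> by (simp add: M_def)
      moreover have "M \<in> posdefs"
        unfolding M_def by (rule convexD_alt[OF convex_posdefs Y(1) X(1)]) auto
      then have "?f X \<le> ?f M" by (rule X(2))
      ultimately show False using Y(2) by simp
    qed
  qed
qed

end

theorem corollary3:
  fixes t \<alpha> \<beta> :: real and m :: nat and w :: "nat \<Rightarrow> real"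
    and A :: "nat \<Rightarrow> complex^'n^'n"
  assumes "0 < t" and "t < 1"
    and "\<And>j. j \<in> {1..m} \<Longrightarrow> A j \<in> posdefs"
    and "\<And>j. j \<in> {1..m} \<Longrightarrow> 0 < w j"
    and "(\<Sum>j=1..m. w j) = 1"
    and "0 < \<alpha>" and "0 < \<beta>"
    and "\<And>j. j \<in> {1..m} \<Longrightarrow> \<alpha> *\<^sub>R mat 1 \<le>\<^sub>L A j \<and> A j \<le>\<^sub>L \<beta> *\<^sub>R mat 1"
  shows "(\<forall>X\<in>posdefs. 0 \<le> phi t m w A X)
    \<and> strictly_convex_on posdefs (phi t m w A)
    \<and> (\<exists>!X. is_arg_min (phi t m w A) (\<lambda>X. X \<in> posdefs) X)
    \<and> k_smooth_on (t * (1 - t) * \<beta> powr (1 - t) * \<alpha> powr (t - 2))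
         {X \<in> posdefs. \<alpha> *\<^sub>R mat 1 \<le>\<^sub>L X \<and> X \<le>\<^sub>L \<beta> *\<^sub>R mat 1} (phi t m w A)
    \<and> k_strongly_convex_on (t * (1 - t) * \<beta> powr (t - 2) * \<alpha> powr (1 - t))
         {X \<in> posdefs. \<alpha> *\<^sub>R mat 1 \<le>\<^sub>L X \<and> X \<le>\<^sub>L \<beta> *\<^sub>R mat 1} (phi t m w A)"
proof -
  interpret weighted_family t m w A
    by (rule weighted_family.intro) (fact assms)+
  have K: "{X \<in> posdefs. \<alpha> *\<^sub>R mat 1 \<le>\<^sub>L X \<and> X \<le>\<^sub>L \<beta> *\<^sub>R mat 1} = loewner_interval \<alpha> \<beta>"
    using lower_bound_posdefs[OF \<open>0 < \<alpha>\<close>] unfolding loewner_interval_def by blast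
  have AK: "A j \<in> loewner_interval \<alpha> \<beta>" if "j \<in> {1..m}" for j
    using assms(8)[OF that] by (simp add: loewner_interval_def)
  have P: "X \<in> posdefs" if "X \<in> loewner_interval \<alpha> \<beta>" for X :: "complex^'n^'n"
    using that loewner_interval_posdefs[OF \<open>0 < \<alpha>\<close>] by blast
  show ?thesis
    unfolding K k_smooth_on_def k_strongly_convex_on_def hs_norm_eq_norm
  proof (intro conjI ballI)
    show "0 \<le> phi t m w A X" if "X \<in> posdefs" for X
      by (rule phi_nonneg[OF that])
    show "strictly_convex_on posdefs (phi t m w A)"
      by (rule phi_strictly_convex)
    show "\<exists>!X. is_arg_min (phi t m w A) (\<lambda>X. X \<in> posdefs) X"
      by (rule phi_unique_minimiser[OF \<open>0 < \<alpha>\<close> AK])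
  next
    fix X :: "complex^'n^'n" assume X: "X \<in> loewner_interval \<alpha> \<beta>"
    show G: "has_gradient (phi t m w A) (gradient (phi t m w A) X) X"
      unfolding gradient_phi[OF P[OF X]] by (rule phi_has_gradient[OF P[OF X]])
    show "has_gradient (phi t m w A) (gradient (phi t m w A) X) X" by (rule G)
    fix Y :: "complex^'n^'n" assume Y: "Y \<in> loewner_interval \<alpha> \<beta>"
    show "norm (gradient (phi t m w A) X - gradient (phi t m w A) Y)
        \<le> t * (1 - t) * \<beta> powr (1 - t) * \<alpha> powr (t - 2) * norm (X - Y)"
      unfolding gradient_phi[OF P[OF X]] gradient_phi[OF P[OF Y]]
      by (rule grad_lipschitz[OF \<open>0 < \<alpha>\<close> \<open>0 < \<beta>\<close> AK X Y])
    show "phi t m w A X + hs_inner (gradient (phi t m w A) X) (Y - X)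
        + t * (1 - t) * \<beta> powr (t - 2) * \<alpha> powr (1 - t) / 2 * (norm (X - Y))\<^sup>2 \<le> phi t m w A Y"
      unfolding gradient_phi[OF P[OF X]]
      by (rule phi_strongly_convex[OF \<open>0 < \<alpha>\<close> \<open>0 < \<beta>\<close> AK X Y])
  qed
qed

end
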